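(* Let $(k,D_k)$ be a differential field, $G$ a linear $D_k$-group over $k$, and $V$ a faithful finite-dimensional representation of $G$. Suppose that $(k,D_k)$ is filtered-linearly closed and linearly $D_k$-closed. Then $G$ is conjugate to a $D_k$-constant subgroup in $\mathrm{GL}(V)$ if and only if there is a (possibly, non-commuting) basis $\partial_1,\ldots,\partial_d$ in $D_k$ over $k$ such that, for all $i$, $1\leqslant i\leqslant d$, $G$ is conjugate to a $\partial_i$-constant subgroup in $\mathrm{GL}(V)$.
   Context: Differential field: a pair $(k,D_k)$, where $k$ is a field of characteristic zero and $D_k$ is a finite-dimensional $k$-vector space with a Lie bracket (additive, not necessarily $k$-linear) and a $k$-linear homomorphism of Lie rings $D_k\to\mathrm{Der}(k,k)$ (not necessarily injective) such that $[\partial,a\delta]=a[\partial,\delta]+\partial(a)\delta$. The superscript $D_k$ denotes the elements annihilated by $D_k$. A $D_k$-module is a $k$-vector space $M$ with a biadditive action of $D_k$, $k$-linear in $D_k$, such that $\partial(am)=\partial(a)m+a\partial(m)$ and $[\partial,\delta]m=\partial(\delta m)-\delta(\partial m)$; it is trivial if $k\otimes_{k^{D_k}}M^{D_k}\to M$ is an isomorphism. Any $k$-subspace $D\subset D_k$ closed under the bracket gives a differential field $(k,D)$; $k$ is linearly $D$-closed if all finite-dimensional $D$-modules over $k$ are trivial. $(k,D_k)$ is filtered-linearly closed if there is a sequence of $k$-subspaces closed under the Lie bracket $0=D_0\subset D_1\subset\ldots\subset D_d=D_k$ with $\dim_k(D_{i+1}/D_i)=1$ and $k$ linearly $D_i$-closed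 for $0\leqslant i\leqslant d-1$. A $D_k$-algebra is a commutative $k$-algebra that is a $D_k$-module with $D_k$ acting by derivations extending the action on $k$. A linear $D_k$-group is a group-valued functor $G$ on $D_k$-algebras represented by a $D_k$-Hopf algebra $A$ that is finitely generated as a $D_k$-algebra: $G(R)=\mathrm{Hom}_{D_k}(A,R)$. A finite-dimensional representation of $G$ is a finite-dimensional $A$-comodule $V$ over $k$ ($A$ viewed as a Hopf algebra); it amounts to a morphism of functors on $D_k$-algebras from $G$ to $\mathrm{GL}(V):R\mapsto\mathrm{Aut}_R(R\otimes_kV)$. It is faithful if this morphism is a closed embedding, that is, $A$ is generated as a $D_k$-algebra by the matrix coefficients of $V$ and the inverse of their determinant. $G$ is conjugate to a ($D_k$-)constant subgroup in $\mathrm{GL}(V)$ if there are a vector space $V_0$ over $k_0:=k^{D_k}$ and an isomorphism $k\otimes_{k_0}V_0\cong V$ of $k$-vector spaces such that for every $D_k$-algebra $R$ the image of $G(R)$ is contained in $\mathrm{Aut}_{R^{D_k}}(R^{D_k}\otimes_{k_0}V_0)$; equivalently, $V$ has a $k$-basis in which all matrix coefficients in $A$ are annihilated by $D_k$. For $\partial\in D_k$, $G$ is conjugate to a $\partial$-constant subgroup in $\mathrm{GL}(V)$ if the same holds with respect to $(k,k\cdot\partial)$: $V$ has a $k$-basis in which all matrix coefficients in $A$ are annihilated by $\partial$. *)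

theory Defs
  imports
    "HOL-Library.Poly_Mapping"
    "HOL-Library.Function_Algebras"
    "HOL-Computational_Algebra.Group_Closure"
    "Jordan_Normal_Form.Determinant"
begin

text \<open>Vector spaces over \<open>k\<close> are given by a scalar multiplication \<open>s :: 'k \<Rightarrow> 'v \<Rightarrow> 'v\<close> satisfying the
  locale \<^locale>\<open>vector_space\<close>; linear subspaces are sets.\<close>

definition finite_dim :: "('k::field \<Rightarrow> 'v::ab_group_add \<Rightarrow> 'v) \<Rightarrow> 'v set \<Rightarrow> bool" where
  "finite_dim s M \<longleftrightarrow> (\<exists>B. finite B \<and> module.span s B = M)"

definition basis_of :: "('k::field \<Rightarrow> 'v::ab_group_add \<Rightarrow> 'v) \<Rightarrow> 'v list \<Rightarrow> bool" where
  "basis_of s bs \<longleftrightarrow>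
     distinct bs \<and> \<not> module.dependent s (set bs) \<and> module.span s (set bs) = UNIV"


section \<open>Tensor products\<close>

text \<open>\<open>V \<otimes>\<^sub>K W\<close> is the quotient of the free abelian group on \<open>V \<times> W\<close> by the subgroup generated by the
  usual relations. Here \<open>V\<close>, \<open>W\<close> are additive subgroups and \<open>K\<close> is a set of scalars acting on them by
  \<open>s\<close> and \<open>t\<close>. The generator \<open>v \<otimes> w\<close> is \<open>frag_of (v, w)\<close>.\<close>

definition tensor_relations ::
  "'k set \<Rightarrow> ('k \<Rightarrow> 'v::ab_group_add \<Rightarrow> 'v) \<Rightarrow> 'v set \<Rightarrow> ('k \<Rightarrow> 'w::ab_group_add \<Rightarrow> 'w) \<Rightarrow> 'w set
    \<Rightarrow> ('v \<times> 'w \<Rightarrow>\<^sub>0 int) set" where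
  "tensor_relations K s V t W = group_closure
     ({frag_of (v + v', w) - frag_of (v, w) - frag_of (v', w) | v v' w. v \<in> V \<and> v' \<in> V \<and> w \<in> W}
    \<union> {frag_of (v, w + w') - frag_of (v, w) - frag_of (v, w') | v w w'. v \<in> V \<and> w \<in> W \<and> w' \<in> W}
    \<union> {frag_of (s c v, w) - frag_of (v, t c w) | c v w. c \<in> K \<and> v \<in> V \<and> w \<in> W})"

definition tensor_rel ::
  "'k set \<Rightarrow> ('k \<Rightarrow> 'v::ab_group_add \<Rightarrow> 'v) \<Rightarrow> 'v set \<Rightarrow> ('k \<Rightarrow> 'w::ab_group_add \<Rightarrow> 'w) \<Rightarrow> 'w set
    \<Rightarrow> (('v \<times> 'w \<Rightarrow>\<^sub>0 int) \<times> ('v \<times> 'w \<Rightarrow>\<^sub>0 int)) set" where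
  "tensor_rel K s V t W =
     {(x, y). Poly_Mapping.keys x \<subseteq> V \<times> W \<and> Poly_Mapping.keys y \<subseteq> V \<times> W
        \<and> x - y \<in> tensor_relations K s V t W}"

definition tensor_product ::
  "'k set \<Rightarrow> ('k \<Rightarrow> 'v::ab_group_add \<Rightarrow> 'v) \<Rightarrow> 'v set \<Rightarrow> ('k \<Rightarrow> 'w::ab_group_add \<Rightarrow> 'w) \<Rightarrow> 'w set
    \<Rightarrow> ('v \<times> 'w \<Rightarrow>\<^sub>0 int) set set" where
  "tensor_product K s V t W =
     {x. Poly_Mapping.keys x \<subseteq> V \<times> W} // tensor_rel K s V t W"

abbreviation tensor_eq ::
  "('k \<Rightarrow> 'v::ab_group_add \<Rightarrow> 'v) \<Rightarrow> ('k \<Rightarrow> 'w::ab_group_add \<Rightarrow> 'w)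
    \<Rightarrow> ('v \<times> 'w \<Rightarrow>\<^sub>0 int) \<Rightarrow> ('v \<times> 'w \<Rightarrow>\<^sub>0 int) \<Rightarrow> bool" where
  "tensor_eq s t x y \<equiv> (x, y) \<in> tensor_rel UNIV s UNIV t UNIV"

text \<open>Equality in the threefold tensor product \<open>V \<otimes>\<^sub>k W \<otimes>\<^sub>k U\<close>.\<close>

definition tensor3_eq ::
  "('k \<Rightarrow> 'v::ab_group_add \<Rightarrow> 'v) \<Rightarrow> ('k \<Rightarrow> 'w::ab_group_add \<Rightarrow> 'w) \<Rightarrow> ('k \<Rightarrow> 'u::ab_group_add \<Rightarrow> 'u)
    \<Rightarrow> ('v \<times> 'w \<times> 'u \<Rightarrow>\<^sub>0 int) \<Rightarrow> ('v \<times> 'w \<times> 'u \<Rightarrow>\<^sub>0 int) \<Rightarrow> bool" where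
  "tensor3_eq s t r x y \<longleftrightarrow> x - y \<in> group_closure
     ({frag_of (v + v', w, u) - frag_of (v, w, u) - frag_of (v', w, u) | v v' w u. True}
    \<union> {frag_of (v, w + w', u) - frag_of (v, w, u) - frag_of (v, w', u) | v w w' u. True}
    \<union> {frag_of (v, w, u + u') - frag_of (v, w, u) - frag_of (v, w, u') | v w u u'. True}
    \<union> {frag_of (s c v, w, u) - frag_of (v, t c w, u) | c v w u. True}
    \<union> {frag_of (v, t c w, u) - frag_of (v, w, r c u) | c v w u. True})"

text \<open>The additive map into a \<open>k\<close>-vector space with values \<open>f p\<close> on the generators \<open>p\<close>.\<close>

definition lin_ext :: "('k::field \<Rightarrow> 'm::ab_group_add \<Rightarrow> 'm) \<Rightarrow> ('p \<Rightarrow> 'm) \<Rightarrow> ('p \<Rightarrow>\<^sub>0 int) \<Rightarrow> 'm" where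
  "lin_ext s f x = (\<Sum>p\<in>Poly_Mapping.keys x. s (of_int (Poly_Mapping.lookup x p)) (f p))"

definition tensor_mult ::
  "('a::comm_ring_1 \<times> 'a \<Rightarrow>\<^sub>0 int) \<Rightarrow> ('a \<times> 'a \<Rightarrow>\<^sub>0 int) \<Rightarrow> ('a \<times> 'a \<Rightarrow>\<^sub>0 int)" where
  "tensor_mult x y =
     frag_extend (\<lambda>(a, b). frag_extend (\<lambda>(c, d). frag_of (a * c, b * d)) y) x"


section \<open>Differential fields and their modules\<close>

text \<open>The vector space \<open>D\<^sub>k\<close> is the whole type \<open>'d\<close>; \<open>der\<close> is the structure map \<open>D\<^sub>k \<rightarrow> Der(k,k)\<close>.\<close>

locale differential_field = D: vector_space dscale
  for dscale :: "'k::field_char_0 \<Rightarrow> 'd::ab_group_add \<Rightarrow> 'd" +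
  fixes bracket :: "'d \<Rightarrow> 'd \<Rightarrow> 'd"
    and der :: "'d \<Rightarrow> 'k \<Rightarrow> 'k"
  assumes finite_dim_D: "finite_dim dscale UNIV"
    and bracket_add_left: "bracket (x + y) z = bracket x z + bracket y z"
    and bracket_add_right: "bracket x (y + z) = bracket x y + bracket x z"
    and bracket_self: "bracket x x = 0"
    and jacobi: "bracket x (bracket y z) + bracket y (bracket z x) + bracket z (bracket x y) = 0"
    and der_add: "der x (a + b) = der x a + der x b"
    and der_mult: "der x (a * b) = der x a * b + a * der x b"
    and der_add_D: "der (x + y) a = der x a + der y a"
    and der_scale_D: "der (dscale c x) a = c * der x a"
    and der_bracket: "der (bracket x y) a = der x (der y a) - der y (der x a)"
    and bracket_scale: "bracket x (dscale a y) = dscale a (bracket x y) + dscale (der x a) y"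

definition lie_subspace ::
  "('k::field \<Rightarrow> 'd::ab_group_add \<Rightarrow> 'd) \<Rightarrow> ('d \<Rightarrow> 'd \<Rightarrow> 'd) \<Rightarrow> 'd set \<Rightarrow> bool" where
  "lie_subspace dscale bracket D \<longleftrightarrow>
     module.subspace dscale D \<and> (\<forall>x\<in>D. \<forall>y\<in>D. bracket x y \<in> D)"

text \<open>Modules over \<open>(k, D)\<close>, with underlying space a subspace \<open>M\<close> of \<open>'m\<close>. Only the values of \<open>act\<close> on
  \<open>D \<times> M\<close> matter.\<close>

locale D_module = differential_field dscale bracket der + M: vector_space mscale
  for dscale :: "'k::field_char_0 \<Rightarrow> 'd::ab_group_add \<Rightarrow> 'd"
    and bracket :: "'d \<Rightarrow> 'd \<Rightarrow> 'd"
    and der :: "'d \<Rightarrow> 'k \<Rightarrow> 'k"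
    and mscale :: "'k \<Rightarrow> 'm::ab_group_add \<Rightarrow> 'm" +
  fixes D :: "'d set" and M :: "'m set" and act :: "'d \<Rightarrow> 'm \<Rightarrow> 'm"
  assumes lie_D: "lie_subspace dscale bracket D"
    and subspace_M: "M.subspace M"
    and act_closed: "\<lbrakk>x \<in> D; m \<in> M\<rbrakk> \<Longrightarrow> act x m \<in> M"
    and act_add: "\<lbrakk>x \<in> D; m \<in> M; n \<in> M\<rbrakk> \<Longrightarrow> act x (m + n) = act x m + act x n"
    and act_add_D: "\<lbrakk>x \<in> D; y \<in> D; m \<in> M\<rbrakk> \<Longrightarrow> act (x + y) m = act x m + act y m"
    and act_scale_D: "\<lbrakk>x \<in> D; m \<in> M\<rbrakk> \<Longrightarrow> act (dscale c x) m = mscale c (act x m)"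
    and act_scale: "\<lbrakk>x \<in> D; m \<in> M\<rbrakk> \<Longrightarrow>
      act x (mscale c m) = mscale (der x c) m + mscale c (act x m)"
    and act_bracket: "\<lbrakk>x \<in> D; y \<in> D; m \<in> M\<rbrakk> \<Longrightarrow>
      act (bracket x y) m = act x (act y m) - act y (act x m)"

definition D_constants :: "('d \<Rightarrow> 'm::ab_group_add \<Rightarrow> 'm) \<Rightarrow> 'd set \<Rightarrow> 'm set \<Rightarrow> 'm set" where
  "D_constants act D M = {m \<in> M. \<forall>x\<in>D. act x m = 0}"

text \<open>The canonical map \<open>k \<otimes>\<^bsub>k\<^sup>D\<^esub> M\<^sup>D \<rightarrow> M\<close>, \<open>c \<otimes> m \<mapsto> c m\<close>. On formal sums it is constant on the classes
  that make up the tensor product, so that \<open>the_elem\<close> picks its value on a class.\<close>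

definition trivial_module ::
  "('d \<Rightarrow> 'k \<Rightarrow> 'k) \<Rightarrow> ('k::field \<Rightarrow> 'm::ab_group_add \<Rightarrow> 'm) \<Rightarrow> 'd set \<Rightarrow> 'm set \<Rightarrow> ('d \<Rightarrow> 'm \<Rightarrow> 'm)
    \<Rightarrow> bool" where
  "trivial_module der mscale D M act \<longleftrightarrow>
     bij_betw (\<lambda>X. the_elem (lin_ext mscale (\<lambda>(c, m). mscale c m) ` X))
       (tensor_product (D_constants der D UNIV) (*) UNIV mscale (D_constants act D M)) M"

text \<open>Every finite-dimensional \<open>k\<close>-vector space is isomorphic to a subspace of \<open>nat \<Rightarrow> 'k\<close>, so that it
  suffices to let \<open>M\<close> range over these.\<close>

definition linearly_closed ::
  "('k::field_char_0 \<Rightarrow> 'd::ab_group_add \<Rightarrow> 'd) \<Rightarrow> ('d \<Rightarrow> 'd \<Rightarrow> 'd) \<Rightarrow> ('d \<Rightarrow> 'k \<Rightarrow> 'k) \<Rightarrow> 'd set \<Rightarrow> bool"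
where
  "linearly_closed dscale bracket der D \<longleftrightarrow>
     (let fscale = (\<lambda>c (v :: nat \<Rightarrow> 'k) i. c * v i) in
      \<forall>M act. D_module dscale bracket der fscale D M act \<and> finite_dim fscale M
        \<longrightarrow> trivial_module der fscale D M act)"

definition filtered_linearly_closed ::
  "('k::field_char_0 \<Rightarrow> 'd::ab_group_add \<Rightarrow> 'd) \<Rightarrow> ('d \<Rightarrow> 'd \<Rightarrow> 'd) \<Rightarrow> ('d \<Rightarrow> 'k \<Rightarrow> 'k) \<Rightarrow> bool" where
  "filtered_linearly_closed dscale bracket der \<longleftrightarrow>
     (\<exists>(d::nat) F. F 0 = {0} \<and> F d = UNIV
        \<and> (\<forall>i\<le>d. lie_subspace dscale bracket (F i))
        \<and> (\<forall>i<d. F i \<subseteq> F (Suc i)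
             \<and> vector_space.dim dscale (F (Suc i)) = vector_space.dim dscale (F i) + 1
             \<and> linearly_closed dscale bracket der (F i)))"


section \<open>Linear differential algebraic groups\<close>

locale D_algebra = D_module dscale bracket der ascale UNIV UNIV act
  for dscale :: "'k::field_char_0 \<Rightarrow> 'd::ab_group_add \<Rightarrow> 'd"
    and bracket :: "'d \<Rightarrow> 'd \<Rightarrow> 'd"
    and der :: "'d \<Rightarrow> 'k \<Rightarrow> 'k"
    and ascale :: "'k \<Rightarrow> 'a::comm_ring_1 \<Rightarrow> 'a"
    and act :: "'d \<Rightarrow> 'a \<Rightarrow> 'a" +
  assumes scale_mult: "ascale c (a * b) = ascale c a * b"
    and act_mult: "act x (a * b) = act x a * b + a * act x b"

definition D_algebra_hom ::
  "('k \<Rightarrow> 'a::comm_ring_1 \<Rightarrow> 'a) \<Rightarrow> ('d \<Rightarrow> 'a \<Rightarrow> 'a) \<Rightarrow> ('k \<Rightarrow> 'r::comm_ring_1 \<Rightarrow> 'r) \<Rightarrow> ('d \<Rightarrow> 'r \<Rightarrow> 'r)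
    \<Rightarrow> ('a \<Rightarrow> 'r) \<Rightarrow> bool" where
  "D_algebra_hom ascale act rscale ract f \<longleftrightarrow>
     (\<forall>a b. f (a + b) = f a + f b) \<and> (\<forall>a b. f (a * b) = f a * f b) \<and> f 1 = 1
     \<and> (\<forall>c a. f (ascale c a) = rscale c (f a)) \<and> (\<forall>x a. f (act x a) = ract x (f a))"

text \<open>\<open>generated_D_subalgebra ascale act S\<close> is the smallest \<open>D\<^sub>k\<close>-subalgebra containing \<open>S\<close>.\<close>

definition D_subalgebra ::
  "('k \<Rightarrow> 'a::comm_ring_1 \<Rightarrow> 'a) \<Rightarrow> ('d \<Rightarrow> 'a \<Rightarrow> 'a) \<Rightarrow> 'a set \<Rightarrow> bool" where
  "D_subalgebra ascale act B \<longleftrightarrow>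
     1 \<in> B \<and> (\<forall>a\<in>B. \<forall>b\<in>B. a + b \<in> B \<and> a * b \<in> B)
     \<and> (\<forall>c. \<forall>a\<in>B. ascale c a \<in> B) \<and> (\<forall>x. \<forall>a\<in>B. act x a \<in> B)"

definition generated_D_subalgebra ::
  "('k \<Rightarrow> 'a::comm_ring_1 \<Rightarrow> 'a) \<Rightarrow> ('d \<Rightarrow> 'a \<Rightarrow> 'a) \<Rightarrow> 'a set \<Rightarrow> 'a set" where
  "generated_D_subalgebra ascale act S = D_subalgebra ascale act hull S"

text \<open>The comultiplication \<open>A \<rightarrow> A \<otimes>\<^sub>k A\<close> is given by a map \<open>comult\<close> that assigns to \<open>a\<close> a formal sum
  representing the image of \<open>a\<close>; no condition other than those in \<open>A \<otimes>\<^sub>k A\<close> is imposed on the choice of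
  representatives. The same convention is used for coactions below.\<close>

locale linear_D_group = D_algebra dscale bracket der ascale act
  for dscale :: "'k::field_char_0 \<Rightarrow> 'd::ab_group_add \<Rightarrow> 'd"
    and bracket :: "'d \<Rightarrow> 'd \<Rightarrow> 'd"
    and der :: "'d \<Rightarrow> 'k \<Rightarrow> 'k"
    and ascale :: "'k \<Rightarrow> 'a::comm_ring_1 \<Rightarrow> 'a"
    and act :: "'d \<Rightarrow> 'a \<Rightarrow> 'a" +
  fixes comult :: "'a \<Rightarrow> ('a \<times> 'a \<Rightarrow>\<^sub>0 int)"
    and counit :: "'a \<Rightarrow> 'k"
    and antipode :: "'a \<Rightarrow> 'a"
  assumes comult_add: "tensor_eq ascale ascale (comult (a + b)) (comult a + comult b)"
    and comult_scale: "tensor_eq ascale ascale (comult (ascale c a))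
      (frag_extend (\<lambda>(p, q). frag_of (ascale c p, q)) (comult a))"
    and comult_mult: "tensor_eq ascale ascale (comult (a * b)) (tensor_mult (comult a) (comult b))"
    and comult_one: "tensor_eq ascale ascale (comult 1) (frag_of (1, 1))"
    and comult_act: "tensor_eq ascale ascale (comult (act x a))
      (frag_extend (\<lambda>(p, q). frag_of (act x p, q) + frag_of (p, act x q)) (comult a))"
    and counit_hom: "D_algebra_hom ascale act (*) der counit"
    and antipode_hom: "D_algebra_hom ascale act ascale act antipode"
    and coassoc: "tensor3_eq ascale ascale ascale
      (frag_extend (\<lambda>(p, q). frag_extend (\<lambda>(p', p''). frag_of (p', p'', q)) (comult p)) (comult a))
      (frag_extend (\<lambda>(p, q). frag_extend (\<lambda>(q', q''). frag_of (p, q', q'')) (comult q)) (comult a))"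
    and counit_left: "lin_ext ascale (\<lambda>(p, q). ascale (counit p) q) (comult a) = a"
    and counit_right: "lin_ext ascale (\<lambda>(p, q). ascale (counit q) p) (comult a) = a"
    and antipode_left: "lin_ext ascale (\<lambda>(p, q). antipode p * q) (comult a) = ascale (counit a) 1"
    and antipode_right: "lin_ext ascale (\<lambda>(p, q). p * antipode q) (comult a) = ascale (counit a) 1"
    and finitely_generated: "\<exists>S. finite S \<and> generated_D_subalgebra ascale act S = UNIV"

text \<open>Finite-dimensional (right) comodules, with coaction \<open>V \<rightarrow> V \<otimes>\<^sub>k A\<close>.\<close>

locale fin_dim_representation = V: vector_space vscale
  for ascale :: "'k::field \<Rightarrow> 'a::comm_ring_1 \<Rightarrow> 'a"
    and comult :: "'a \<Rightarrow> ('a \<times> 'a \<Rightarrow>\<^sub>0 int)"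
    and counit :: "'a \<Rightarrow> 'k"
    and vscale :: "'k \<Rightarrow> 'v::ab_group_add \<Rightarrow> 'v" +
  fixes coact :: "'v \<Rightarrow> ('v \<times> 'a \<Rightarrow>\<^sub>0 int)"
  assumes finite_dim_V: "finite_dim vscale UNIV"
    and coact_add: "tensor_eq vscale ascale (coact (v + w)) (coact v + coact w)"
    and coact_scale: "tensor_eq vscale ascale (coact (vscale c v))
      (frag_extend (\<lambda>(u, a). frag_of (vscale c u, a)) (coact v))"
    and coact_coassoc: "tensor3_eq vscale ascale ascale
      (frag_extend (\<lambda>(u, a). frag_extend (\<lambda>(u', a'). frag_of (u', a', a)) (coact u)) (coact v))
      (frag_extend (\<lambda>(u, a). frag_extend (\<lambda>(a', a''). frag_of (u, a', a'')) (comult a)) (coact v))"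
    and coact_counit: "lin_ext vscale (\<lambda>(u, a). vscale (counit a) u) (coact v) = v"

text \<open>\<open>P\<close> is the matrix of coefficients of \<open>V\<close> in the basis \<open>e\<close>: the coaction sends \<open>e\<^sub>j\<close> to
  \<open>\<Sum>\<^sub>i e\<^sub>i \<otimes> P\<^sub>i\<^sub>j\<close>.\<close>

definition coefficient_matrix ::
  "('k::field \<Rightarrow> 'a::comm_ring_1 \<Rightarrow> 'a) \<Rightarrow> ('k \<Rightarrow> 'v::ab_group_add \<Rightarrow> 'v) \<Rightarrow> ('v \<Rightarrow> ('v \<times> 'a \<Rightarrow>\<^sub>0 int))
    \<Rightarrow> 'v list \<Rightarrow> 'a mat \<Rightarrow> bool" where
  "coefficient_matrix ascale vscale coact e P \<longleftrightarrow>
     basis_of vscale e \<and> P \<in> carrier_mat (length e) (length e)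
     \<and> (\<forall>j<length e. tensor_eq vscale ascale (coact (e ! j))
          (\<Sum>i<length e. frag_of (e ! i, P $$ (i, j))))"

definition faithful_representation ::
  "('k::field \<Rightarrow> 'a::comm_ring_1 \<Rightarrow> 'a) \<Rightarrow> ('d \<Rightarrow> 'a \<Rightarrow> 'a) \<Rightarrow> ('k \<Rightarrow> 'v::ab_group_add \<Rightarrow> 'v)
    \<Rightarrow> ('v \<Rightarrow> ('v \<times> 'a \<Rightarrow>\<^sub>0 int)) \<Rightarrow> bool" where
  "faithful_representation ascale act vscale coact \<longleftrightarrow>
     (\<exists>e P u. coefficient_matrix ascale vscale coact e P \<and> u * det P = 1
        \<and> generated_D_subalgebra ascale act (insert u (elements_mat P)) = UNIV)"

text \<open>Conjugacy to a \<open>D\<close>-constant subgroup in \<open>GL(V)\<close>: some basis of \<open>V\<close> has all its matrix coefficients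
  annihilated by the elements of \<open>D\<close>.\<close>

definition conjugate_to_constant ::
  "('k::field \<Rightarrow> 'a::comm_ring_1 \<Rightarrow> 'a) \<Rightarrow> ('d \<Rightarrow> 'a \<Rightarrow> 'a) \<Rightarrow> ('k \<Rightarrow> 'v::ab_group_add \<Rightarrow> 'v)
    \<Rightarrow> ('v \<Rightarrow> ('v \<times> 'a \<Rightarrow>\<^sub>0 int)) \<Rightarrow> 'd set \<Rightarrow> bool" where
  "conjugate_to_constant ascale act vscale coact D \<longleftrightarrow>
     (\<exists>e P. coefficient_matrix ascale vscale coact e P
        \<and> elements_mat P \<subseteq> D_constants act D UNIV)"

text \<open>In terms of points: in a basis with \<open>D\<close>-constant coefficients, the matrix by which \<open>g \<in> G(R)\<close> acts on
  \<open>R \<otimes>\<^sub>k V\<close> has its entries in \<open>R\<^sup>D\<close>. Conversely, the entries are the coefficients themselves for the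
  universal point \<open>id \<in> G(A)\<close>.\<close>

lemma constant_coefficients_point:
  assumes "D_algebra_hom ascale act rscale ract g"
    and "elements_mat P \<subseteq> D_constants act D UNIV"
  shows "elements_mat (map_mat g P) \<subseteq> D_constants ract D UNIV"
proof -
  have add: "g (a + b) = g a + g b" and act: "g (act x a) = ract x (g a)" for a b x
    using assms(1) by (auto simp: D_algebra_hom_def)
  have "g 0 = 0"
    using add[of 0 0] by simp
  then have "ract x (g a) = 0" if "a \<in> D_constants act D UNIV" "x \<in> D" for a x
    using act[of x a] that by (simp add: D_constants_def)
  then show ?thesis
    using assms(2) by (fastforce simp: elements_mat_def D_constants_def)
qed

lemma universal_point: "D_algebra_hom ascale act ascale act id"
  by (simp add: D_algebra_hom_def)

end

theory Submission
  imports Defs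
begin

text \<open>Let \<open>P\<close> be the coefficient matrix of \<open>V\<close> in some basis. The \<open>x \<in> D\<^sub>k\<close> for which there is a matrix
  \<open>N\<close> over \<open>k\<close> with \<open>x P = [N, P]\<close> form a subspace, and conjugacy to an \<open>x\<close>-constant subgroup puts \<open>x\<close>
  into it; hence the hypothesis on a basis of \<open>D\<^sub>k\<close> gives such an \<open>N\<close> for every \<open>x\<close>. One then climbs the
  filtration. After a change of basis \<open>P\<close> is \<open>D\<^sub>i\<close>-constant. The \<open>D\<^sub>i\<close>-module \<open>D\<^sub>i\<^sub>+\<^sub>1/D\<^sub>i\<close> is trivial, so
  \<open>D\<^sub>i\<^sub>+\<^sub>1 = D\<^sub>i + k d\<close> with \<open>[D\<^sub>i, d] \<subseteq> D\<^sub>i\<close>. If \<open>d P = [N, P]\<close>, then \<open>x N\<close> commutes with \<open>P\<close> for all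
  \<open>x \<in> D\<^sub>i\<close>, and subtracting from \<open>N\<close> a matrix that commutes with \<open>P\<close> one may take \<open>N\<close> to be
  \<open>D\<^sub>i\<close>-constant. So \<open>x + c d \<mapsto> x + c (d - N)\<close> is a flat connection of \<open>D\<^sub>i\<^sub>+\<^sub>1\<close> on \<open>k\<^sup>n\<close>, and a basis of
  horizontal vectors makes \<open>P\<close> constant for \<open>D\<^sub>i\<^sub>+\<^sub>1\<close>.\<close>

section \<open>Square matrices\<close>

text \<open>An \<open>n \<times> n\<close> matrix is a function on pairs of indices that vanishes outside \<open>{..<n} \<times> {..<n}\<close>; then
  the associative and distributive laws hold without any side condition.\<close>

definition sq_mats :: "nat \<Rightarrow> (nat \<Rightarrow> nat \<Rightarrow> 'r::comm_ring_1) set" where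
  "sq_mats n = {A. \<forall>i j. i \<ge> n \<or> j \<ge> n \<longrightarrow> A i j = 0}"

definition mmult ::
  "nat \<Rightarrow> (nat \<Rightarrow> nat \<Rightarrow> 'r::comm_ring_1) \<Rightarrow> (nat \<Rightarrow> nat \<Rightarrow> 'r) \<Rightarrow> nat \<Rightarrow> nat \<Rightarrow> 'r" where
  "mmult n A B i j = (\<Sum>l<n. A i l * B l j)"

definition mone :: "nat \<Rightarrow> nat \<Rightarrow> nat \<Rightarrow> 'r::comm_ring_1" where
  "mone n i j = (if i = j \<and> i < n then 1 else 0)"

definition inverse_mats :: "nat \<Rightarrow> (nat \<Rightarrow> nat \<Rightarrow> 'r::comm_ring_1) \<Rightarrow> (nat \<Rightarrow> nat \<Rightarrow> 'r) \<Rightarrow> bool" where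
  "inverse_mats n g h \<longleftrightarrow> g \<in> sq_mats n \<and> h \<in> sq_mats n \<and> mmult n g h = mone n \<and> mmult n h g = mone n"

lemma sq_mats_mmult [simp]: "A \<in> sq_mats n \<Longrightarrow> B \<in> sq_mats n \<Longrightarrow> mmult n A B \<in> sq_mats n"
  by (auto simp: sq_mats_def mmult_def intro!: sum.neutral)

lemma sq_mats_mone [simp]: "mone n \<in> sq_mats n"
  by (auto simp: sq_mats_def mone_def)

lemma sq_mats_zero [simp]: "0 \<in> sq_mats n"
  and sq_mats_add: "A \<in> sq_mats n \<Longrightarrow> B \<in> sq_mats n \<Longrightarrow> A + B \<in> sq_mats n"
  and sq_mats_diff: "A \<in> sq_mats n \<Longrightarrow> B \<in> sq_mats n \<Longrightarrow> A - B \<in> sq_mats n"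
  and sq_mats_scale: "A \<in> sq_mats n \<Longrightarrow> (\<lambda>i j. c * A i j) \<in> sq_mats n"
  by (auto simp: sq_mats_def)

lemma sq_mats_eqI:
  assumes "A \<in> sq_mats n" "B \<in> sq_mats n" "\<And>i j. i < n \<Longrightarrow> j < n \<Longrightarrow> A i j = B i j"
  shows "A = B"
proof (intro ext)
  fix i j
  show "A i j = B i j"
    using assms by (cases "i < n \<and> j < n") (auto simp: sq_mats_def)
qed

lemma mmult_assoc: "mmult n (mmult n A B) C = mmult n A (mmult n B C)"
proof (intro ext)
  fix i j
  have "mmult n (mmult n A B) C i j = (\<Sum>l<n. \<Sum>m<n. A i m * (B m l * C l j))"
    by (simp add: mmult_def sum_distrib_right mult.assoc)
  also have "\<dots> = (\<Sum>m<n. \<Sum>l<n. A i m * (B m l * C l j))"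
    by (rule sum.swap)
  finally show "mmult n (mmult n A B) C i j = mmult n A (mmult n B C) i j"
    by (simp add: mmult_def sum_distrib_left)
qed

lemma mmult_add_left: "mmult n (A + B) C = mmult n A C + mmult n B C"
  and mmult_add_right: "mmult n A (B + C) = mmult n A B + mmult n A C"
  and mmult_diff_left: "mmult n (A - B) C = mmult n A C - mmult n B C"
  and mmult_diff_right: "mmult n A (B - C) = mmult n A B - mmult n A C"
  and mmult_uminus_left: "mmult n (- A) C = - mmult n A C"
  by (auto simp: fun_eq_iff mmult_def algebra_simps sum.distrib sum_subtractf sum_negf)

lemma mmult_zero [simp]: "mmult n 0 A = 0" "mmult n A 0 = 0"
  by (auto simp: fun_eq_iff mmult_def)

lemma mmult_mone_right [simp]: "A \<in> sq_mats n \<Longrightarrow> mmult n A (mone n) = A"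
  by (auto simp: fun_eq_iff mmult_def mone_def sq_mats_def if_distrib cong: if_cong)

lemma mmult_mone_left [simp]:
  assumes "A \<in> sq_mats n"
  shows "mmult n (mone n) A = A"
proof (intro ext)
  fix i j
  have "mmult n (mone n) A i j = (\<Sum>l<n. if i = l then A l j else 0)"
    unfolding mmult_def mone_def by (rule sum.cong) auto
  then show "mmult n (mone n) A i j = A i j"
    using assms by (auto simp: sq_mats_def)
qed

lemma inverse_mats_mone: "inverse_mats n (mone n) (mone n)"
  by (simp add: inverse_mats_def)

lemma inverse_mats_mmult:
  assumes "inverse_mats n g h" "inverse_mats n g' h'"
  shows "inverse_mats n (mmult n g g') (mmult n h' h)"
proof -
  have "mmult n (mmult n g g') (mmult n h' h) = mmult n g (mmult n (mmult n g' h') h)"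
    "mmult n (mmult n h' h) (mmult n g g') = mmult n h' (mmult n (mmult n h g) g')"
    by (simp_all only: mmult_assoc)
  then show ?thesis
    using assms by (simp add: inverse_mats_def)
qed

lemma inverse_mats_cancel:
  assumes "inverse_mats n g h" "A \<in> sq_mats n"
  shows "mmult n g (mmult n h A) = A" "mmult n h (mmult n g A) = A"
  using assms by (simp_all add: inverse_mats_def flip: mmult_assoc)

text \<open>The matrix \<open>g\<close> has a right inverse since its columns span, and this is a left inverse since the
  columns are independent.\<close>

lemma inverse_mats_from_columns:
  fixes g :: "nat \<Rightarrow> nat \<Rightarrow> 'r::comm_ring_1"
  assumes g: "g \<in> sq_mats n"
    and span: "\<And>j. j < n \<Longrightarrow> \<exists>a. \<forall>i<n. (\<Sum>l<n. g i l * a l) = mone n i j"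
    and indep: "\<And>a. (\<And>i. i < n \<Longrightarrow> (\<Sum>l<n. g i l * a l) = 0) \<Longrightarrow> (\<forall>l<n. a l = 0)"
  obtains h where "inverse_mats n g h"
proof -
  obtain c where c: "\<And>i j. i < n \<Longrightarrow> j < n \<Longrightarrow> (\<Sum>l<n. g i l * c j l) = mone n i j"
    using span by metis
  define h where "h = (\<lambda>l j. if l < n \<and> j < n then c j l else 0)"
  have h: "h \<in> sq_mats n"
    by (auto simp: h_def sq_mats_def)
  have gh: "mmult n g h = mone n"
    by (rule sq_mats_eqI[of _ n]) (use g h c in \<open>simp_all add: mmult_def h_def\<close>)
  \<comment> \<open>Every column of \<open>h g - 1\<close> is thus a relation among the columns of
    \<open>g\<close>, which \<open>indep\<close> forces to be zero.\<close>
  have z: "mmult n g (mmult n h g - mone n) = 0"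
    using g gh by (simp add: mmult_diff_right flip: mmult_assoc)
  have "mmult n h g = mone n"
  proof (rule sq_mats_eqI[of _ n])
    fix i j assume ij: "i < n" "j < n"
    have "\<forall>l<n. (mmult n h g - mone n) l j = 0"
    proof (rule indep)
      fix i
      show "(\<Sum>l<n. g i l * (mmult n h g - mone n) l j) = 0"
        using fun_cong[OF fun_cong[OF z, of i], of j]
        by (simp add: mmult_def[of n g "mmult n h g - mone n"])
    qed
    then show "mmult n h g i j = mone n i j"
      using ij by simp
  qed (use g h in auto)
  then show ?thesis
    using that g h gh by (auto simp: inverse_mats_def)
qed

text \<open>Take for \<open>S\<close> a minimal set of coordinates that determine the elements of \<open>H\<close>.\<close>

lemma pivot_coordinates:
  fixes H :: "(nat \<Rightarrow> nat \<Rightarrow> 'k::field) set"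
  assumes sub: "H \<subseteq> sq_mats n"
    and zero: "0 \<in> H"
    and add: "\<And>A B. A \<in> H \<Longrightarrow> B \<in> H \<Longrightarrow> A + B \<in> H"
    and scale: "\<And>c A. A \<in> H \<Longrightarrow> (\<lambda>i j. c * A i j) \<in> H"
  obtains S where "\<And>A. A \<in> H \<Longrightarrow> (\<And>i j. (i, j) \<in> S \<Longrightarrow> A i j = 0) \<Longrightarrow> A = 0"
    and "\<And>v. \<exists>A\<in>H. \<forall>(i, j)\<in>S. A i j = v i j"
proof -
  \<comment> \<open>\<open>det S\<close> is not a determinant: it says that the entries at the
    positions in \<open>S\<close> determine a matrix of \<open>H\<close>.\<close>
  define det where "det S \<longleftrightarrow> S \<subseteq> {..<n} \<times> {..<n} \<and> (\<forall>A\<in>H. (\<forall>(i, j)\<in>S. A i j = 0) \<longrightarrow> A = 0)"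
    for S
  have "det ({..<n} \<times> {..<n})"
    unfolding det_def
  proof (intro conjI ballI impI)
    fix A assume A: "A \<in> H" "\<forall>(i, j)\<in>{..<n} \<times> {..<n}. A i j = 0"
    then have "A \<in> sq_mats n"
      using sub by auto
    then show "A = 0"
      by (rule sq_mats_eqI) (use A in \<open>auto simp: sq_mats_def\<close>)
  qed auto
  then obtain S where det: "det S" and min: "\<And>T. det T \<Longrightarrow> card S \<le> card T"
    using ex_has_least_nat[of det _ card] by metis
  have S: "S \<subseteq> {..<n} \<times> {..<n}" "\<And>A. A \<in> H \<Longrightarrow> (\<And>i j. (i, j) \<in> S \<Longrightarrow> A i j = 0) \<Longrightarrow> A = 0"
    using det by (auto simp: det_def)
  have fin: "finite S"
    using S(1) finite_subset by blast
  \<comment> \<open>By minimality, dropping \<open>(i, j)\<close> from \<open>S\<close> admits a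
    nonzero matrix of \<open>H\<close> that vanishes at the other positions. Its entry at
    \<open>(i, j)\<close> cannot vanish, so it can be scaled to 1.\<close>
  have unit: "\<exists>A\<in>H. A i j = 1 \<and> (\<forall>(i', j')\<in>S - {(i, j)}. A i' j' = 0)" if "(i, j) \<in> S" for i j
  proof -
    have "\<not> det (S - {(i, j)})"
      using min[of "S - {(i, j)}"] fin that by (metis card_Diff1_less linorder_not_less)
    then obtain A where A: "A \<in> H" "\<forall>(i', j')\<in>S - {(i, j)}. A i' j' = 0" "A \<noteq> 0"
      using S(1) unfolding det_def by blast
    then have "A i j \<noteq> 0"
      using S(2)[of A] by blast
    then show ?thesis
      using A scale[OF A(1), of "1 / A i j"] by (intro bexI[of _ "\<lambda>i' j'. 1 / A i j * A i' j'"]) auto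
  qed
  \<comment> \<open>Prescribed values are reached one position at a time, by adding multiples of the
    matrices from \<open>unit\<close>. Keeping the entries on \<open>S - T\<close> at zero lets the
    next position be adjusted freely.\<close>
  have "\<exists>A\<in>H. (\<forall>(i, j)\<in>T. A i j = v i j) \<and> (\<forall>(i, j)\<in>S - T. A i j = 0)" if "T \<subseteq> S" for v T
    using finite_subset[OF that fin] that
  proof (induction T)
    case empty
    then show ?case using zero by (intro bexI[of _ 0]) auto
  next
    case (insert p T)
    obtain i j where p: "p = (i, j)" by force
    obtain A where A: "A \<in> H" "\<forall>(i, j)\<in>T. A i j = v i j" "\<forall>(i, j)\<in>S - T. A i j = 0"
      using insert by auto
    obtain U where U: "U \<in> H" "U i j = 1" "\<forall>(i', j')\<in>S - {(i, j)}. U i' j' = 0"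
      using unit[of i j] insert p by auto
    have "A + (\<lambda>i' j'. v i j * U i' j') \<in> H"
      using add[OF A(1) scale[OF U(1), of "v i j"]] .
    moreover have "A i' j' + v i j * U i' j' = v i' j'" if "(i', j') \<in> insert p T" for i' j'
    proof (cases "(i', j') = p")
      case True
      then have "(i', j') \<in> S - T" using insert by auto
      then show ?thesis using A(3) U(2) True p by auto
    next
      case False
      then have "(i', j') \<in> T" "(i', j') \<in> S - {(i, j)}" using that insert p by auto
      then have "A i' j' = v i' j'" "U i' j' = 0" using A(2) U(3) by blast+
      then show ?thesis by simp
    qed
    moreover have "A i' j' + v i j * U i' j' = 0" if "(i', j') \<in> S - insert p T" for i' j'
    proof -
      have "(i', j') \<in> S - T" "(i', j') \<in> S - {(i, j)}" using that p by auto
      then have "A i' j' = 0" "U i' j' = 0" using A(3) U(3) by blast+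
      then show ?thesis by simp
    qed
    ultimately show ?case
      by (intro bexI[of _ "A + (\<lambda>i' j'. v i j * U i' j')"]) auto
  qed
  from this[OF subset_refl] have "\<exists>A\<in>H. \<forall>(i, j)\<in>S. A i j = v i j" for v
    by blast
  then show ?thesis
    using that[of S] S(2) by blast
qed

section \<open>Coordinates\<close>

context vector_space
begin

lemma basis_ofI:
  assumes span: "\<And>v. \<exists>a. v = (\<Sum>i<length es. scale (a i) (es ! i))"
    and indep: "\<And>a. (\<Sum>i<length es. scale (a i) (es ! i)) = 0 \<Longrightarrow> \<forall>i<length es. a i = 0"
  shows "basis_of scale es"
proof -
  have dist: "distinct es"
  proof (rule ccontr)
    assume "\<not> distinct es"
    then obtain i j where ij: "i < length es" "j < length es" "i \<noteq> j" "es ! i = es ! j"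
      by (auto simp: distinct_conv_nth)
    \<comment> \<open>A repeated vector would give the nontrivial relation
      \<open>es ! i - es ! j = 0\<close>.\<close>
    define a :: "nat \<Rightarrow> 'a" where "a l = (if l = i then 1 else if l = j then - 1 else 0)" for l
    have "(\<Sum>l<length es. scale (a l) (es ! l)) = (\<Sum>l\<in>{i, j}. scale (a l) (es ! l))"
      by (rule sum.mono_neutral_right) (use ij in \<open>auto simp: a_def\<close>)
    also have "\<dots> = 0"
      using ij by (simp add: a_def)
    finally have "a i = 0"
      using indep ij by blast
    then show False by (simp add: a_def)
  qed
  then have bij: "bij_betw ((!) es) {..<length es} (set es)"
    by (intro bij_betw_nth) auto
  have "independent (set es)"
  proof (rule independent_if_scalars_zero)
    fix f v assume 0: "(\<Sum>x\<in>set es. scale (f x) x) = 0" and v: "v \<in> set es"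
    have "(\<Sum>i<length es. scale (f (es ! i)) (es ! i)) = 0"
      using 0 sum.reindex_bij_betw[OF bij, of "\<lambda>x. scale (f x) x"] by simp
    then show "f v = 0"
      using indep[of "\<lambda>i. f (es ! i)"] v by (auto simp: in_set_conv_nth)
  qed auto
  moreover have "v \<in> span (set es)" for v
  proof -
    obtain a where "v = (\<Sum>i<length es. scale (a i) (es ! i))"
      using span by blast
    moreover have "\<dots> \<in> span (set es)"
      by (rule span_sum) (simp add: span_scale span_base)
    ultimately show ?thesis by simp
  qed
  ultimately show ?thesis
    using dist by (auto simp: basis_of_def)
qed

lemma basis_of_same_length:
  assumes "basis_of scale es" "basis_of scale es'"
  shows "length es = length es'"
proof -
  obtain f where "bij_betw f (set es) (set es')"
    using bij_if_span_eq_span_bases[of "set es" "set es'"] assms by (auto simp: basis_of_def)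
  then show ?thesis
    using assms by (metis basis_of_def bij_betw_same_card distinct_card)
qed

lemma basis_of_exists:
  assumes "finite_dim scale UNIV"
  obtains es where "basis_of scale es"
proof -
  obtain B where B: "finite B" "span B = UNIV"
    using assms by (auto simp: finite_dim_def)
  then obtain C where C: "C \<subseteq> B" "independent C" "B \<subseteq> span C"
    using maximal_independent_subset by blast
  then have "span C = UNIV"
    using B span_mono span_span by (metis top.extremum_uniqueI)
  moreover obtain es where "set es = C" "distinct es"
    using B C finite_distinct_list finite_subset by metis
  ultimately show ?thesis
    using that C by (auto simp: basis_of_def)
qed

end

locale based_vector_space = vector_space scale
  for scale :: "'a::field \<Rightarrow> 'b::ab_group_add \<Rightarrow> 'b" +
  fixes es :: "'b list"
  assumes es: "basis_of scale es"
begin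

definition coords :: "'b \<Rightarrow> nat \<Rightarrow> 'a" where
  "coords v i = representation (set es) v (es ! i)"

lemma basis_of_facts: "distinct es" "independent (set es)" "span (set es) = UNIV"
  using es by (auto simp: basis_of_def)

lemma sum_coords: "(\<Sum>i<length es. scale (coords v i) (es ! i)) = v"
proof -
  have "bij_betw ((!) es) {..<length es} (set es)"
    by (intro bij_betw_nth) (use basis_of_facts in auto)
  then have "(\<Sum>i<length es. scale (coords v i) (es ! i)) =
      (\<Sum>x\<in>set es. scale (representation (set es) v x) x)"
    unfolding coords_def by (rule sum.reindex_bij_betw)
  then show ?thesis
    using basis_of_facts sum_representation_eq[of "set es" v "set es"] by auto
qed

lemma coords_add: "coords (v + w) i = coords v i + coords w i"
  and coords_scale: "coords (scale c v) i = c * coords v i"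
  and coords_sum: "coords (\<Sum>j\<in>J. f j) i = (\<Sum>j\<in>J. coords (f j) i)"
  using basis_of_facts
  by (simp_all add: coords_def representation_add representation_scale representation_sum)

lemma coords_nth: "i < length es \<Longrightarrow> j < length es \<Longrightarrow> coords (es ! i) j = (if i = j then 1 else 0)"
  using basis_of_facts by (simp add: coords_def representation_basis nth_eq_iff_index_eq)

lemma coords_lincomb:
  assumes "j < length es"
  shows "coords (\<Sum>i<length es. scale (a i) (es ! i)) j = a j"
proof -
  have "coords (\<Sum>i<length es. scale (a i) (es ! i)) j = (\<Sum>i<length es. if i = j then a i else 0)"
    unfolding coords_sum coords_scale by (rule sum.cong) (use assms coords_nth in auto)
  then show ?thesis
    using assms by simp
qed

end

text \<open>Expand \<open>es ! j\<close> in the basis \<open>es'\<close> and take coordinates in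
  \<open>es\<close>. Used with the two bases in either order, this makes the transition matrices
  mutually inverse.\<close>

lemma basis_change_inverse:
  assumes "based_vector_space scale es" "based_vector_space scale es'" and n: "n = length es"
  shows "mmult n (\<lambda>i j. if i < n \<and> j < n then based_vector_space.coords scale es (es' ! j) i else 0)
     (\<lambda>i j. if i < n \<and> j < n then based_vector_space.coords scale es' (es ! j) i else 0) = mone n"
proof -
  interpret e: based_vector_space scale es by fact
  interpret e': based_vector_space scale es' by fact
  have n': "length es' = n"
    using e.basis_of_same_length[OF e.es e'.es] n by simp
  show ?thesis
  proof (rule sq_mats_eqI[of _ n])
    fix i j assume ij: "i < n" "j < n"
    have "mone n i j = e.coords (es ! j) i"
      using e.coords_nth ij n by (simp add: mone_def)
    also have "es ! j = (\<Sum>l<n. scale (e'.coords (es ! j) l) (es' ! l))"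
      using e'.sum_coords[of "es ! j"] n' by simp
    also have "e.coords \<dots> i = (\<Sum>l<n. e.coords (es' ! l) i * e'.coords (es ! j) l)"
      by (simp add: e.coords_sum e.coords_scale mult.commute)
    finally show "mmult n (\<lambda>i j. if i < n \<and> j < n then e.coords (es' ! j) i else 0)
       (\<lambda>i j. if i < n \<and> j < n then e'.coords (es ! j) i else 0) i j = mone n i j"
      using ij by (simp add: mmult_def)
  qed (auto simp: sq_mats_def mmult_def mone_def intro!: sum.neutral)
qed

section \<open>Tensor products with a based vector space\<close>

context vector_space
begin

lemma lin_ext_superset:
  assumes "finite S" "Poly_Mapping.keys x \<subseteq> S"
  shows "lin_ext scale f x = (\<Sum>p\<in>S. scale (of_int (Poly_Mapping.lookup x p)) (f p))"
  unfolding lin_ext_def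
  by (rule sum.mono_neutral_left) (use assms in \<open>auto simp: in_keys_iff\<close>)

lemma lin_ext_frag_of [simp]: "lin_ext scale f (frag_of p) = f p"
  by (simp add: lin_ext_def)

lemma lin_ext_0 [simp]: "lin_ext scale f 0 = 0"
  by (simp add: lin_ext_def)

lemma lin_ext_diff: "lin_ext scale f (x - y) = lin_ext scale f x - lin_ext scale f y"
proof -
  let ?S = "Poly_Mapping.keys x \<union> Poly_Mapping.keys y"
  have "Poly_Mapping.keys (x - y) \<subseteq> ?S"
    by (auto simp: in_keys_iff lookup_minus)
  then show ?thesis
    by (simp add: lin_ext_superset[of ?S] lookup_minus scale_left_diff_distrib sum_subtractf)
qed

lemma lin_ext_add: "lin_ext scale f (x + y) = lin_ext scale f x + lin_ext scale f y"
  using lin_ext_diff[of f x "0 - y"] lin_ext_diff[of f 0 y] by simp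

lemma lin_ext_sum: "lin_ext scale f (\<Sum>i\<in>I. g i) = (\<Sum>i\<in>I. lin_ext scale f (g i))"
  by (induction I rule: infinite_finite_induct) (simp_all add: lin_ext_add)

text \<open>Universal property of the tensor product: a biadditive map balanced over
  \<open>K\<close> kills the defining relations, so its extension to formal sums descends to
  classes.\<close>

lemma lin_ext_tensor_relations:
  assumes "x \<in> tensor_relations K s V t W"
    and "\<And>v v' w. v \<in> V \<Longrightarrow> v' \<in> V \<Longrightarrow> w \<in> W \<Longrightarrow> f (v + v', w) = f (v, w) + f (v', w)"
    and "\<And>v w w'. v \<in> V \<Longrightarrow> w \<in> W \<Longrightarrow> w' \<in> W \<Longrightarrow> f (v, w + w') = f (v, w) + f (v, w')"
    and "\<And>c v w. c \<in> K \<Longrightarrow> v \<in> V \<Longrightarrow> w \<in> W \<Longrightarrow> f (s c v, w) = f (v, t c w)"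
  shows "lin_ext scale f x = 0"
  using assms(1) unfolding tensor_relations_def
proof (induction rule: group_closure.induct)
  case (base x)
  then show ?case
    using assms(2-4) by (auto simp: lin_ext_diff)
next
  case (diff x y)
  then show ?case
    by (simp add: lin_ext_diff)
qed

end

section \<open>Congruence rules for equality of tensors\<close>

lemma tensor_eq_iff: "tensor_eq s t x y \<longleftrightarrow> x - y \<in> tensor_relations UNIV s UNIV t UNIV"
  by (simp add: tensor_rel_def)

lemma tensor_eq_trans: "tensor_eq s t x y \<Longrightarrow> tensor_eq s t y z \<Longrightarrow> tensor_eq s t x z"
  using group_closure_add[of "x - y" _ "y - z"] by (auto simp: tensor_eq_iff tensor_relations_def)

lemma tensor_eq_sym: "tensor_eq s t x y \<Longrightarrow> tensor_eq s t y x"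
  using group_closure_minus_iff[of "x - y"] by (auto simp: tensor_eq_iff tensor_relations_def)

lemma tensor_eq_refl [simp]: "tensor_eq s t x x"
  by (simp add: tensor_eq_iff tensor_relations_def)

lemma tensor_eq_diff:
  assumes "tensor_eq s t x y" "tensor_eq s t x' y'"
  shows "tensor_eq s t (x - x') (y - y')"
proof -
  have "x - x' - (y - y') = (x - y) - (x' - y')" by simp
  then show ?thesis
    using assms unfolding tensor_eq_iff tensor_relations_def by (simp only: group_closure.diff)
qed

lemma tensor_eq_add:
  assumes "tensor_eq s t x y" "tensor_eq s t x' y'"
  shows "tensor_eq s t (x + x') (y + y')"
  using tensor_eq_diff[OF assms(1) tensor_eq_diff[OF tensor_eq_refl[of 0] assms(2)]] by simp

lemma tensor_eq_sum:
  assumes "\<And>i. i \<in> I \<Longrightarrow> tensor_eq s t (f i) (g i)"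
  shows "tensor_eq s t (\<Sum>i\<in>I. f i) (\<Sum>i\<in>I. g i)"
  using assms by (induction I rule: infinite_finite_induct) (auto intro!: tensor_eq_add)

lemma tensor_eq_add_left: "tensor_eq s t (frag_of (v + v', w)) (frag_of (v, w) + frag_of (v', w))"
  and tensor_eq_add_right: "tensor_eq s t (frag_of (v, w + w')) (frag_of (v, w) + frag_of (v, w'))"
  and tensor_eq_scale: "tensor_eq s t (frag_of (s c v, w)) (frag_of (v, t c w))"
  unfolding tensor_eq_iff tensor_relations_def diff_diff_eq[symmetric]
  by (rule group_closure.base, blast)+

lemma tensor_eq_diff_right: "tensor_eq s t (frag_of (v, w - w')) (frag_of (v, w) - frag_of (v, w'))"
  using tensor_eq_diff[OF tensor_eq_refl[of "frag_of (v, w)"] tensor_eq_refl[of "frag_of (v, w')"]]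
    tensor_eq_sym[OF tensor_eq_diff[OF tensor_eq_add_right[of v "w - w'" w' s t] tensor_eq_refl[of "frag_of (v, w')"]]]
  by (simp add: tensor_eq_sym)

lemma tensor_eq_zero_left: "tensor_eq s t (frag_of (0, w)) 0"
  using tensor_eq_diff[OF tensor_eq_add_left[of 0 0 w s t] tensor_eq_refl[of "frag_of (0, w)"]]
  by (simp add: tensor_eq_sym)

lemma tensor_eq_sum_left:
  "tensor_eq s t (frag_of (\<Sum>i\<in>I. v i, w)) (\<Sum>i\<in>I. frag_of (v i, w))"
proof (induction I rule: infinite_finite_induct)
  case (insert i I)
  then show ?case
    using tensor_eq_trans[OF tensor_eq_add_left tensor_eq_add[OF tensor_eq_refl insert.IH]] by simp
qed (simp_all add: tensor_eq_zero_left)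

locale based_tensor = based_vector_space vscale es + A: vector_space ascale
  for vscale :: "'k::field \<Rightarrow> 'v::ab_group_add \<Rightarrow> 'v" and es
    and ascale :: "'k \<Rightarrow> 'a::comm_ring_1 \<Rightarrow> 'a"
begin

text \<open>The map \<open>V \<otimes> A \<rightarrow> A\<close> induced by the \<open>i\<close>-th
  coordinate functional of \<open>V\<close>, evaluated on formal sums.\<close>

definition tcoef :: "nat \<Rightarrow> ('v \<times> 'a \<Rightarrow>\<^sub>0 int) \<Rightarrow> 'a" where
  "tcoef i x = lin_ext ascale (\<lambda>(v, a). ascale (coords v i) a) x"

lemma tcoef_tensor_eq:
  assumes "tensor_eq vscale ascale x y"
  shows "tcoef i x = tcoef i y"
proof -
  have "lin_ext ascale (\<lambda>(v, a). ascale (coords v i) a) (x - y) = 0"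
    by (rule A.lin_ext_tensor_relations[OF assms[unfolded tensor_eq_iff]])
      (simp_all add: coords_add coords_scale A.scale_left_distrib A.scale_right_distrib mult.commute)
  then show ?thesis
    by (simp add: tcoef_def A.lin_ext_diff)
qed

text \<open>Existence of coordinates in \<open>V \<otimes> A\<close>, which is free over
  \<open>A\<close> on the basis of \<open>V\<close>; uniqueness comes from
  \<open>tcoef_tensor_eq\<close> and \<open>tcoef_expand\<close>. It suffices to treat generators
  and differences.\<close>

lemma tensor_eq_expand: "tensor_eq vscale ascale x (\<Sum>i<length es. frag_of (es ! i, tcoef i x))"
  using subset_UNIV[of "Poly_Mapping.keys x"]
proof (induction x rule: frag_induction)
  case zero
  have "tensor_eq vscale ascale 0 (frag_of (v, 0))" for v
    using tensor_eq_diff_right[of v 0 0 vscale ascale] by (simp add: tensor_eq_sym)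
  then show ?case
    using tensor_eq_sum[of "{..<length es}" "\<lambda>i. 0" "\<lambda>i. frag_of (es ! i, 0)" vscale ascale]
    by (simp add: tcoef_def)
next
  case (one p)
  obtain v a where p: "p = (v, a)" by force
  have "tensor_eq vscale ascale (frag_of (v, a)) (\<Sum>i<length es. frag_of (vscale (coords v i) (es ! i), a))"
    using tensor_eq_sum_left[of "\<lambda>i. vscale (coords v i) (es ! i)" "{..<length es}" a vscale ascale]
    by (simp add: sum_coords)
  moreover have "tensor_eq vscale ascale (\<Sum>i<length es. frag_of (vscale (coords v i) (es ! i), a))
      (\<Sum>i<length es. frag_of (es ! i, tcoef i (frag_of p)))"
    by (rule tensor_eq_sum) (simp add: tcoef_def p tensor_eq_scale)
  ultimately show ?case
    using p tensor_eq_trans by blast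
next
  case (diff x y)
  have "tensor_eq vscale ascale (\<Sum>i<length es. frag_of (es ! i, tcoef i (x - y)))
     (\<Sum>i<length es. frag_of (es ! i, tcoef i x) - frag_of (es ! i, tcoef i y))"
    by (rule tensor_eq_sum) (simp add: tcoef_def A.lin_ext_diff tensor_eq_diff_right)
  then show ?case
    using tensor_eq_trans[OF tensor_eq_diff[OF diff] tensor_eq_sym] by (simp add: sum_subtractf)
qed

lemma tcoef_expand:
  assumes "j < length es"
  shows "tcoef j (\<Sum>i<length es. frag_of (es ! i, a i)) = a j"
proof -
  have "tcoef j (\<Sum>i<length es. frag_of (es ! i, a i)) = (\<Sum>i<length es. if i = j then a i else 0)"
    unfolding tcoef_def A.lin_ext_sum by (rule sum.cong) (use assms coords_nth in auto)
  then show ?thesis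
    using assms by simp
qed

text \<open>By uniqueness of coordinates in \<open>V \<otimes> A\<close>, a basis has exactly one
  coefficient matrix, independent of the representatives chosen by \<open>coact\<close>.\<close>

lemma coefficient_matrix_iff:
  "coefficient_matrix ascale vscale coact es P \<longleftrightarrow> P \<in> carrier_mat (length es) (length es)
     \<and> (\<forall>i<length es. \<forall>j<length es. P $$ (i, j) = tcoef i (coact (es ! j)))"
proof -
  have "tensor_eq vscale ascale x (\<Sum>i<length es. frag_of (es ! i, a i))
      \<longleftrightarrow> (\<forall>i<length es. a i = tcoef i x)" for x a
  proof
    assume "tensor_eq vscale ascale x (\<Sum>i<length es. frag_of (es ! i, a i))"
    then show "\<forall>i<length es. a i = tcoef i x"
      using tcoef_tensor_eq[of x "\<Sum>i<length es. frag_of (es ! i, a i)"] by (simp add: tcoef_expand)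
  next
    assume "\<forall>i<length es. a i = tcoef i x"
    then show "tensor_eq vscale ascale x (\<Sum>i<length es. frag_of (es ! i, a i))"
      using tensor_eq_expand[of x] by simp
  qed
  then show ?thesis
    using es by (auto simp: coefficient_matrix_def)
qed

text \<open>The coaction is linear only up to \<open>tensor_eq\<close>; composing it with
  \<open>tcoef\<close> gives an honestly linear map into \<open>A\<close>.\<close>

lemma tcoef_linear:
  fixes n :: nat
  assumes add: "\<And>v w. tensor_eq vscale ascale (coact (v + w)) (coact v + coact w)"
    and scale: "\<And>c v. tensor_eq vscale ascale (coact (vscale c v))
      (frag_extend (\<lambda>(u, a). frag_of (vscale c u, a)) (coact v))"
  shows "tcoef i (coact (\<Sum>l<n. vscale (c l) (v l))) = (\<Sum>l<n. ascale (c l) (tcoef i (coact (v l))))"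
proof -
  have "tcoef i (frag_extend (\<lambda>(u, a). frag_of (vscale c u, a)) x) = ascale c (tcoef i x)" for c x
    using subset_UNIV[of "Poly_Mapping.keys x"]
    by (induction x rule: frag_induction)
      (auto simp: tcoef_def frag_extend_diff A.lin_ext_diff A.scale_right_diff_distrib coords_scale)
  then have *: "tcoef i (coact (vscale c v)) = ascale c (tcoef i (coact v))" for c v
    using tcoef_tensor_eq[OF scale] by simp
  have **: "tcoef i (coact (v + w)) = tcoef i (coact v) + tcoef i (coact w)" for v w
    using tcoef_tensor_eq[OF add] by (simp add: tcoef_def A.lin_ext_add)
  have "tcoef i (coact 0) = 0"
    using *[of 0 0] by simp
  then show ?thesis
    by (induction n) (simp_all add: * **)
qed

end

text \<open>Apply the coordinate functional of the new basis to the expansion of \<open>x\<close> in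
  the old one.\<close>

lemma tcoef_change:
  assumes "based_tensor vscale es ascale" "based_tensor vscale es' ascale"
  shows "based_tensor.tcoef vscale es' ascale m x =
    (\<Sum>i<length es. ascale (based_vector_space.coords vscale es' (es ! i) m)
       (based_tensor.tcoef vscale es ascale i x))"
proof -
  interpret e: based_tensor vscale es ascale by fact
  interpret e': based_tensor vscale es' ascale by fact
  show ?thesis
    using e'.tcoef_tensor_eq[OF e.tensor_eq_expand[of x], of m]
    by (simp add: e'.tcoef_def e.A.lin_ext_sum)
qed

section \<open>Solving linear differential equations\<close>

text \<open>The canonical map is onto, so \<open>m\<close> is its value on some class. Evaluation is
  constant on that class, hence \<open>the_elem\<close> returns the value at any representative, and
  this is a combination of constants.\<close>

lemma (in vector_space) trivial_module_span:
  assumes triv: "trivial_module der scale D M act" and m: "m \<in> M"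
  shows "m \<in> span (D_constants act D M)"
proof -
  let ?K = "D_constants der D UNIV" and ?C = "D_constants act D M"
  let ?ev = "\<lambda>x :: 'a \<times> 'b \<Rightarrow>\<^sub>0 int. lin_ext scale (\<lambda>(c, m). scale c m) x"
  obtain X where X: "X \<in> tensor_product ?K (*) UNIV scale ?C" "m = the_elem (?ev ` X)"
    using triv m unfolding trivial_module_def bij_betw_def by blast
  then obtain x where x: "Poly_Mapping.keys x \<subseteq> UNIV \<times> ?C" "X = tensor_rel ?K (*) UNIV scale ?C `` {x}"
    by (auto simp: tensor_product_def quotient_def)
  have "?ev y = ?ev x" if "y \<in> X" for y
  proof -
    have "x - y \<in> tensor_relations ?K (*) UNIV scale ?C"
      using that x by (auto simp: tensor_rel_def)
    then have "?ev (x - y) = 0"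
      by (rule lin_ext_tensor_relations)
        (auto simp: scale_left_distrib scale_right_distrib mult.commute)
    then show ?thesis
      by (simp add: lin_ext_diff)
  qed
  moreover have "x \<in> X"
    using x by (auto simp: tensor_rel_def tensor_relations_def)
  ultimately have "?ev ` X = {?ev x}"
    by blast
  then have "m = ?ev x"
    using X by simp
  also have "\<dots> \<in> span ?C"
    unfolding lin_ext_def
  proof (intro span_sum span_scale)
    fix p assume "p \<in> Poly_Mapping.keys x"
    then have "snd p \<in> ?C"
      using x(1) by auto
    then show "(case p of (c, m) \<Rightarrow> scale c m) \<in> span ?C"
      by (simp add: case_prod_unfold span_scale span_base)
  qed
  finally show ?thesis .
qed

section \<open>Bases of the coordinate space \<open>k^n\<close>\<close>

interpretation fun_space: vector_space "\<lambda>c (v :: nat \<Rightarrow> 'k::field) i. c * v i"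
  by unfold_locales (auto simp: fun_eq_iff algebra_simps)

lemma fun_space_sum_apply: "(\<Sum>x\<in>S. f x) i = (\<Sum>x\<in>S. f x i)"
  for f :: "'x \<Rightarrow> nat \<Rightarrow> 'k::field"
  by (induction S rule: infinite_finite_induct) auto

lemma unit_vectors_span: "fun_space.span ((\<lambda>i j. if i = j then 1 else 0) ` {..<n}) = {v :: nat \<Rightarrow> 'k::field. \<forall>i\<ge>n. v i = 0}"
  (is "fun_space.span ?B = ?M")
proof
  have "fun_space.subspace ?M"
    by (auto simp: fun_space.subspace_def)
  then show "fun_space.span ?B \<subseteq> ?M"
    by (intro fun_space.span_minimal) auto
  show "?M \<subseteq> fun_space.span ?B"
  proof
    fix v assume v: "v \<in> ?M"
    have "(\<Sum>i<n. v i * (if i = j then 1 else 0)) = (\<Sum>i<n. if i = j then v i else 0)" for j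
      by (rule sum.cong) auto
    then have "v = (\<Sum>i<n. (\<lambda>j. v i * (if i = j then 1 else 0)))"
      using v by (auto simp: fun_eq_iff fun_space_sum_apply)
    also have "\<dots> \<in> fun_space.span ?B"
      by (rule fun_space.span_sum, rule fun_space.span_scale, rule fun_space.span_base) auto
    finally show "v \<in> fun_space.span ?B" .
  qed
qed

lemma unit_vectors_independent:
  "fun_space.independent ((\<lambda>i j. if i = j then 1 else 0 :: 'k::field) ` {..<n})"
proof (rule fun_space.independent_if_scalars_zero)
  fix f :: "(nat \<Rightarrow> 'k) \<Rightarrow> 'k" and v
  let ?u = "\<lambda>i j. if i = j then 1 else 0 :: 'k"
  assume 0: "(\<Sum>x\<in>?u ` {..<n}. (\<lambda>i. f x * x i)) = 0" and v: "v \<in> ?u ` {..<n}"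
  have inj: "inj_on ?u {..<n}"
    by (auto simp: inj_on_def fun_eq_iff split: if_splits)
  obtain i where i: "i < n" "v = ?u i"
    using v by auto
  have "(\<Sum>x\<in>?u ` {..<n}. (\<lambda>i. f x * x i)) i = (\<Sum>j<n. f (?u j) * ?u j i)"
    by (simp add: sum.reindex[OF inj] fun_space_sum_apply)
  also have "\<dots> = (\<Sum>j<n. if j = i then f (?u j) else 0)"
    by (rule sum.cong) auto
  also have "\<dots> = f v"
    using i by simp
  finally show "f v = 0"
    using 0 by simp
qed auto

text \<open>A maximal independent subset of \<open>C\<close> is a basis of the same space as the
  \<open>n\<close> unit vectors. It therefore has \<open>n\<close> elements, which become the
  columns of \<open>g\<close>.\<close>

lemma basis_matrix_from_spanning:
  fixes C :: "(nat \<Rightarrow> 'k::field) set"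
  assumes C: "C \<subseteq> {v. \<forall>i\<ge>n. v i = 0}" and span: "{v. \<forall>i\<ge>n. v i = 0} \<subseteq> fun_space.span C"
  obtains g h where "inverse_mats n g h" "\<And>j. j < n \<Longrightarrow> (\<lambda>i. g i j) \<in> C"
proof -
  let ?M = "{v :: nat \<Rightarrow> 'k. \<forall>i\<ge>n. v i = 0}"
  let ?u = "\<lambda>i j. if i = j then 1 else 0 :: 'k"
  obtain B where B: "B \<subseteq> C" "fun_space.independent B" "C \<subseteq> fun_space.span B"
    using fun_space.maximal_independent_subset by blast
  have spanB: "fun_space.span B = fun_space.span (?u ` {..<n})"
    unfolding unit_vectors_span
  proof
    have "fun_space.subspace ?M"
      by (auto simp: fun_space.subspace_def)
    then show "fun_space.span B \<subseteq> ?M"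
      using B C by (intro fun_space.span_minimal) auto
    show "?M \<subseteq> fun_space.span B"
      using span B(3) fun_space.span_minimal[OF B(3)] by auto
  qed
  have inj: "inj_on ?u {..<n}"
    by (auto simp: inj_on_def fun_eq_iff split: if_splits)
  obtain f where "bij_betw f (?u ` {..<n}) B"
    using fun_space.bij_if_span_eq_span_bases[OF unit_vectors_independent[of n] B(2)] spanB by auto
  then have "bij_betw (f \<circ> ?u) {..<n} B"
    using inj_on_imp_bij_betw[OF inj] bij_betw_trans by blast
  then obtain b where b: "bij_betw b {..<n} B"
    by blast
  define g where "g = (\<lambda>i j. if j < n then b j i else 0)"
  have bB: "b j \<in> B" if "j < n" for j
    using b that by (auto simp: bij_betw_def)
  have "b j i = 0" if "j < n" "i \<ge> n" for i j
    using bB[OF that(1)] B(1) C that(2) by auto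
  then have g: "g \<in> sq_mats n"
    by (auto simp: g_def sq_mats_def)
  have finB: "finite B"
    using b bij_betw_finite by blast
  have reindex: "(\<Sum>x\<in>B. (\<lambda>i. a x * x i)) i = (\<Sum>l<n. g i l * a (b l))" for a i
    using sum.reindex_bij_betw[OF b, of "\<lambda>x. (\<lambda>i. a x * x i)", symmetric]
    by (simp add: fun_space_sum_apply g_def mult.commute)
  obtain h where h: "inverse_mats n g h"
  proof (rule inverse_mats_from_columns[OF g])
    fix j assume "j < n"
    then have "?u j \<in> fun_space.span B"
      unfolding spanB by (intro fun_space.span_base) auto
    then obtain a where a: "?u j = (\<Sum>x\<in>B. (\<lambda>i. a x * x i))"
      unfolding fun_space.span_finite[OF finB] by auto
    then have "mone n i j = (\<Sum>l<n. g i l * a (b l))" if "i < n" for i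
      using fun_cong[OF a, of i] that unfolding reindex by (auto simp: mone_def)
    then show "\<exists>a. \<forall>i<n. (\<Sum>l<n. g i l * a l) = mone n i j"
      by (intro exI[of _ "\<lambda>l. a (b l)"]) simp
  next
    fix a assume a: "\<And>i. i < n \<Longrightarrow> (\<Sum>l<n. g i l * a l) = 0"
    \<comment> \<open>Coefficients indexed by columns are carried over to coefficients indexed by
      the vectors of \<open>B\<close>, where independence applies.\<close>
    define a' where "a' = (\<lambda>x. a (the_inv_into {..<n} b x))"
    have a'b: "a' (b l) = a l" if "l < n" for l
      using b that by (simp add: a'_def bij_betw_def the_inv_into_f_f)
    have "(\<Sum>x\<in>B. (\<lambda>i. a' x * x i)) = 0"
    proof
      fix i
      show "(\<Sum>x\<in>B. (\<lambda>i. a' x * x i)) i = 0 i"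
        unfolding reindex using a[of i] a'b g by (cases "i < n") (auto simp: sq_mats_def)
    qed
    then have "a' x = 0" if "x \<in> B" for x
      using fun_space.independentD[OF B(2) finB subset_refl] that by blast
    then show "\<forall>l<n. a l = 0"
      using a'b bB by force
  qed
  then show ?thesis
    using that[of g h] bB B(1) by (auto simp: g_def)
qed

context differential_field
begin

lemma der_zero [simp]: "der x 0 = 0"
  using der_add[of x 0 0] by simp

lemma der_diff: "der x (a - b) = der x a - der x b"
  using der_add[of x "a - b" b] by simp

lemma der_minus: "der x (- a) = - der x a"
  using der_diff[of x 0 a] by simp

lemma der_sum: "der x (\<Sum>i\<in>I. f i) = (\<Sum>i\<in>I. der x (f i))"
  by (induction I rule: infinite_finite_induct) (simp_all add: der_add)

lemma der_one [simp]: "der x 1 = 0"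
  using der_mult[of x 1 1] by simp

text \<open>The conditions say that \<open>x \<mapsto> x - \<kappa>(x) N\<close> is a flat connection on \<open>k\<^sup>n\<close>.\<close>

lemma linearly_closed_solve:
  assumes closed: "linearly_closed dscale bracket der D" and lie: "lie_subspace dscale bracket D"
    and add: "\<And>x y. x \<in> D \<Longrightarrow> y \<in> D \<Longrightarrow> \<kappa> (x + y) = \<kappa> x + \<kappa> y"
    and scale: "\<And>c x. x \<in> D \<Longrightarrow> \<kappa> (dscale c x) = c * \<kappa> x"
    and flat: "\<And>x y. x \<in> D \<Longrightarrow> y \<in> D \<Longrightarrow> \<kappa> (bracket x y) = der x (\<kappa> y) - der y (\<kappa> x)"
    and N: "N \<in> sq_mats n"
    and derN: "\<And>x i j. x \<in> D \<Longrightarrow> der x (N i j) = \<kappa> x * N' i j"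
  obtains g h where "inverse_mats n g h"
    and "\<And>x i j. x \<in> D \<Longrightarrow> der x (g i j) = \<kappa> x * mmult n N g i j"
proof -
  let ?M = "{v :: nat \<Rightarrow> 'k. \<forall>i\<ge>n. v i = 0}"
  define mv where "mv A v i = (\<Sum>j<n. A i j * v j)" for A and v :: "nat \<Rightarrow> 'k" and i :: nat
  define nabla where "nabla x v i = der x (v i) - \<kappa> x * mv N v i" for x v i
  have mv_add: "mv A (v + w) i = mv A v i + mv A w i"
    and mv_diff: "mv A (\<lambda>j. v j - w j) i = mv A v i - mv A w i"
    and mv_scale: "mv A (\<lambda>j. c * v j) i = c * mv A v i" for A v w c i
    by (simp_all add: mv_def algebra_simps sum.distrib sum_subtractf sum_distrib_left)
  have der_mv: "der x (mv N v i) = \<kappa> x * mv N' v i + mv N (\<lambda>j. der x (v j)) i" if "x \<in> D" for x v i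
    using that by (simp add: mv_def der_sum der_mult derN sum.distrib sum_distrib_left mult.assoc)
  have mv_nabla: "mv N (nabla x v) i = mv N (\<lambda>j. der x (v j)) i - \<kappa> x * mv N (mv N v) i" for x v i
    unfolding nabla_def mv_diff mv_scale ..
  have mod: "D_module dscale bracket der (\<lambda>c v i. c * v i) D ?M nabla"
  proof unfold_locales
    show "lie_subspace dscale bracket D" by fact
    show "fun_space.subspace ?M" by (auto simp: fun_space.subspace_def)
  next
    fix x v assume "x \<in> D" "v \<in> ?M"
    then show "nabla x v \<in> ?M"
      using N by (auto simp: nabla_def mv_def sq_mats_def)
  next
    fix x v w assume "x \<in> D" "v \<in> ?M" "w \<in> ?M"
    show "nabla x (v + w) = nabla x v + nabla x w"
      by (simp add: fun_eq_iff nabla_def mv_add der_add algebra_simps)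
  next
    fix x y v assume "x \<in> D" "y \<in> D" "v \<in> ?M"
    then show "nabla (x + y) v = nabla x v + nabla y v"
      by (simp add: fun_eq_iff nabla_def add der_add_D algebra_simps)
  next
    fix x v c assume "x \<in> D" "v \<in> ?M"
    then show "nabla (dscale c x) v = (\<lambda>i. c * nabla x v i)"
      by (simp add: fun_eq_iff nabla_def scale der_scale_D algebra_simps)
  next
    fix x v c assume "x \<in> D" "v \<in> ?M"
    then show "nabla x (\<lambda>i. c * v i) = (\<lambda>i. der x c * v i) + (\<lambda>i. c * nabla x v i)"
      by (simp add: fun_eq_iff nabla_def mv_scale der_mult algebra_simps)
  next
    fix x y v assume xy: "x \<in> D" "y \<in> D" "v \<in> ?M"
    \<comment> \<open>Vanishing of the curvature: the terms with \<open>N'\<close>, with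
      \<open>N\<close> applied twice and with \<open>N\<close> applied to derivatives of
      \<open>v\<close> are symmetric in \<open>x\<close> and \<open>y\<close> and cancel. What is
      left agrees by \<open>flat\<close>.\<close>
    show "nabla (bracket x y) v = nabla x (nabla y v) - nabla y (nabla x v)"
    proof
      fix i
      have 2: "nabla x (nabla y v) i = der x (der y (v i)) - (der x (\<kappa> y) * mv N v i
          + \<kappa> y * (\<kappa> x * mv N' v i + mv N (\<lambda>j. der x (v j)) i))
          - \<kappa> x * (mv N (\<lambda>j. der y (v j)) i - \<kappa> y * mv N (mv N v) i)"
        if "x \<in> D" for x y
        using that unfolding nabla_def[of x "nabla y v"] nabla_def[of y v i] mv_nabla der_diff der_mult
        by (simp only: der_mv)
      have "nabla (bracket x y) v i = der x (der y (v i)) - der y (der x (v i))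
          - (der x (\<kappa> y) - der y (\<kappa> x)) * mv N v i"
        using xy(1,2) by (simp only: nabla_def der_bracket flat)
      moreover have "p - q - (s - t) * m = p - (s * m + b * (a * m' + u)) - a * (w - b * z)
          - (q - (t * m + a * (b * m' + w)) - b * (u - a * z))" for p q s t m a b m' u w z :: 'k
        by (simp add: algebra_simps)
      ultimately show "nabla (bracket x y) v i = (nabla x (nabla y v) - nabla y (nabla x v)) i"
        by (simp only: fun_diff_def 2[OF xy(1)] 2[OF xy(2)])
    qed
  qed
  have "finite_dim (\<lambda>c v i. c * v i) ?M"
    unfolding finite_dim_def using unit_vectors_span[of n] by blast
  then have triv: "trivial_module der (\<lambda>c v i. c * v i) D ?M nabla"
    using closed mod by (auto simp: linearly_closed_def Let_def)
  let ?C = "D_constants nabla D ?M"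
  \<comment> \<open>Triviality makes the horizontal vectors span, so the columns of \<open>g\<close>
    can be taken horizontal; that is the differential equation for \<open>g\<close>.\<close>
  obtain g h where gh: "inverse_mats n g h" and C: "\<And>j. j < n \<Longrightarrow> (\<lambda>i. g i j) \<in> ?C"
    by (rule basis_matrix_from_spanning[of ?C n])
      (use fun_space.trivial_module_span[OF triv] in \<open>auto simp: D_constants_def\<close>)
  have "der x (g i j) = \<kappa> x * mmult n N g i j" if x: "x \<in> D" for x i j
  proof (cases "j < n")
    case True
    then have "nabla x (\<lambda>i. g i j) i = 0"
      using C x by (auto simp: D_constants_def)
    then show ?thesis
      by (simp add: nabla_def mv_def mmult_def)
  next
    case False
    then show ?thesis
      using gh by (auto simp: inverse_mats_def sq_mats_def mmult_def)
  qed
  then show ?thesis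
    using that gh by blast
qed

end

section \<open>Lie subspaces of codimension one\<close>

context differential_field
begin

section \<open>Bracket identities and linear forms with kernel \<open>D\<close>\<close>

lemma bracket_0_right [simp]: "bracket x 0 = 0"
  using bracket_add_right[of x 0 0] by simp

lemma bracket_minus_right: "bracket x (- y) = - bracket x y"
  using bracket_add_right[of x y "- y"] by (simp add: eq_neg_iff_add_eq_0 add.commute)

lemma bracket_flip: "bracket x y = - bracket y x"
  using bracket_self[of "x + y"] unfolding bracket_add_left bracket_add_right
  by (simp add: bracket_self eq_neg_iff_add_eq_0 add.commute)

lemma bracket_scale_left: "bracket (dscale a x) y = dscale a (bracket x y) - dscale (der y a) x"
  using bracket_flip[of "dscale a x" y] bracket_flip[of x y]
  by (simp add: bracket_scale algebra_simps)

lemma bracket_bracket: "bracket (bracket x y) z = bracket x (bracket y z) - bracket y (bracket x z)"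
proof -
  have "bracket y (bracket z x) = - bracket y (bracket x z)"
    using bracket_flip[of z x] by (simp add: bracket_minus_right)
  then have "bracket x (bracket y z) - bracket y (bracket x z) - bracket (bracket x y) z = 0"
    using jacobi[of x y z] bracket_flip[of z "bracket x y"] by simp
  then show ?thesis
    by (simp only: right_minus_eq)
qed

lemma codim_one_complement:
  assumes D: "D.subspace D" "D.subspace D'" "D \<subseteq> D'" and dim: "D.dim D' = D.dim D + 1"
  obtains d where "d \<in> D'" "d \<notin> D" "\<And>x. x \<in> D' \<Longrightarrow> \<exists>c. x - dscale c d \<in> D"
proof -
  obtain es where es: "basis_of dscale es"
    using D.basis_of_exists finite_dim_D by blast
  interpret F: finite_dimensional_vector_space dscale "set es"
    by unfold_locales (use es in \<open>auto simp: basis_of_def\<close>)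
  obtain d where d: "d \<in> D'" "d \<notin> D"
    using D(3) dim by (metis Suc_eq_plus1 n_not_Suc_n subsetI subset_antisym)
  have spanD: "D.span D = D"
    using D(1) D.span_eq_iff by blast
  have "D.span (insert d D) = D'"
  proof (rule F.subspace_dim_equal)
    show "D.span (insert d D) \<subseteq> D'"
      using d D by (intro D.span_minimal) auto
    show "D.dim D' \<le> D.dim (D.span (insert d D))"
      using d(2) dim unfolding D.dim_span F.dim_insert spanD by simp
  qed (use D in auto)
  then have "\<exists>c. x - dscale c d \<in> D" if "x \<in> D'" for x
    using that spanD by (auto simp: D.span_insert)
  then show ?thesis
    using that d by blast
qed

text \<open>\<open>\<kappa> x\<close> is the coefficient of \<open>d\<close> in \<open>x\<close>
  modulo \<open>D\<close>. It is unique because \<open>d\<close> lies outside \<open>D\<close>, and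
  uniqueness yields linearity.\<close>

lemma codim_one_form:
  assumes D: "D.subspace D" "D.subspace D'" "D \<subseteq> D'" and d: "d \<in> D'" "d \<notin> D"
    and ex: "\<And>x. x \<in> D' \<Longrightarrow> \<exists>c. x - dscale c d \<in> D"
  obtains \<kappa> where "\<And>x. x \<in> D' \<Longrightarrow> x - dscale (\<kappa> x) d \<in> D"
    and "\<kappa> d = 1" and "\<And>x. x \<in> D \<Longrightarrow> \<kappa> x = 0"
    and "\<And>x y. x \<in> D' \<Longrightarrow> y \<in> D' \<Longrightarrow> \<kappa> (x + y) = \<kappa> x + \<kappa> y"
    and "\<And>c x. x \<in> D' \<Longrightarrow> \<kappa> (dscale c x) = c * \<kappa> x"
proof -
  obtain \<kappa> where \<kappa>: "x - dscale (\<kappa> x) d \<in> D" if "x \<in> D'" for x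
    using ex by metis
  have uniq: "\<kappa> x = c" if x: "x \<in> D'" "x - dscale c d \<in> D" for x c
  proof (rule ccontr)
    assume ne: "\<kappa> x \<noteq> c"
    have "dscale (\<kappa> x - c) d = (x - dscale c d) - (x - dscale (\<kappa> x) d)"
      by (simp add: D.scale_left_diff_distrib)
    also have "\<dots> \<in> D"
      using D(1) x \<kappa> D.subspace_diff by blast
    finally have "dscale (1 / (\<kappa> x - c)) (dscale (\<kappa> x - c) d) \<in> D"
      using D(1) D.subspace_scale by blast
    then show False
      using d ne by simp
  qed
  show ?thesis
  proof (rule that[of \<kappa>])
    fix x assume "x \<in> D'"
    then show "x - dscale (\<kappa> x) d \<in> D" by (rule \<kappa>)
  next
    show "\<kappa> d = 1"
      using d D D.subspace_0 by (intro uniq) auto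
  next
    fix x assume "x \<in> D"
    then show "\<kappa> x = 0"
      using D by (intro uniq) auto
  next
    fix x y assume xy: "x \<in> D'" "y \<in> D'"
    have "x + y - dscale (\<kappa> x + \<kappa> y) d = (x - dscale (\<kappa> x) d) + (y - dscale (\<kappa> y) d)"
      by (simp add: D.scale_left_distrib)
    also have "\<dots> \<in> D"
      using D(1) xy \<kappa> D.subspace_add by blast
    finally show "\<kappa> (x + y) = \<kappa> x + \<kappa> y"
      using D xy D.subspace_add by (intro uniq) auto
  next
    fix c x assume x: "x \<in> D'"
    have "dscale c x - dscale (c * \<kappa> x) d = dscale c (x - dscale (\<kappa> x) d)"
      by (simp add: D.scale_right_diff_distrib)
    also have "\<dots> \<in> D"
      using D(1) x \<kappa> D.subspace_scale by blast
    finally show "\<kappa> (dscale c x) = c * \<kappa> x"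
      using D x D.subspace_scale by (intro uniq) auto
  qed
qed

text \<open>Write \<open>x = u + a d\<close> and \<open>y = v + b d\<close> with \<open>u\<close>,
  \<open>v\<close> in \<open>D\<close> and expand; \<open>[u, v]\<close> stays in \<open>D\<close>.
  The last two terms measure the failure of \<open>[D, d] \<subseteq> D\<close> and are the
  obstruction to \<open>\<kappa>\<close> being closed.\<close>

lemma codim_one_form_bracket:
  assumes D: "lie_subspace dscale bracket D" "lie_subspace dscale bracket D'" "D \<subseteq> D'" and d: "d \<in> D'"
    and \<kappa>: "\<And>x. x \<in> D' \<Longrightarrow> x - dscale (\<kappa> x) d \<in> D" "\<kappa> d = 1" "\<And>x. x \<in> D \<Longrightarrow> \<kappa> x = 0"
    and add: "\<And>x y. x \<in> D' \<Longrightarrow> y \<in> D' \<Longrightarrow> \<kappa> (x + y) = \<kappa> x + \<kappa> y"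
    and scale: "\<And>c x. x \<in> D' \<Longrightarrow> \<kappa> (dscale c x) = c * \<kappa> x"
    and xy: "x \<in> D'" "y \<in> D'"
  shows "\<kappa> (bracket x y) = der x (\<kappa> y) - der y (\<kappa> x)
    + \<kappa> y * \<kappa> (bracket (x - dscale (\<kappa> x) d) d) - \<kappa> x * \<kappa> (bracket (y - dscale (\<kappa> y) d) d)"
proof -
  have sub': "D.subspace D'"
    and br: "\<And>x y. x \<in> D \<Longrightarrow> y \<in> D \<Longrightarrow> bracket x y \<in> D"
    and br': "\<And>x y. x \<in> D' \<Longrightarrow> y \<in> D' \<Longrightarrow> bracket x y \<in> D'"
    using D by (auto simp: lie_subspace_def)
  note closed = D.subspace_add[OF sub'] D.subspace_scale[OF sub'] br'
  define u a v b where "u = x - dscale (\<kappa> x) d" and "a = \<kappa> x" and "v = y - dscale (\<kappa> y) d" and "b = \<kappa> y"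
  have uv: "u \<in> D" "v \<in> D" "u \<in> D'" "v \<in> D'"
    using \<kappa>(1) xy D(3) by (auto simp: u_def v_def)
  have x: "x = u + dscale a d" and y: "y = v + dscale b d"
    by (simp_all add: u_def v_def a_def b_def)
  have "bracket x y = bracket u v + (dscale b (bracket u d) + dscale (der u b) d)
      + (dscale (- a) (bracket v d) + dscale (- der v a) d)
      + (dscale (a * der d b) d + dscale (- (b * der d a)) d)"
    unfolding x y
    by (simp add: bracket_add_left bracket_add_right bracket_scale bracket_scale_left bracket_self
        bracket_flip[of d v] der_scale_D der_add_D D.scale_right_diff_distrib D.scale_left_diff_distrib
        D.scale_right_distrib D.scale_left_distrib mult.commute)
  then have "\<kappa> (bracket x y) = \<kappa> (bracket u v) + (b * \<kappa> (bracket u d) + der u b)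
      + (- a * \<kappa> (bracket v d) + - der v a) + (a * der d b + - (b * der d a))"
    by (simp only: add scale closed uv d \<kappa>(2) mult_1_right)
  moreover have "\<kappa> (bracket u v) = 0"
    using uv br \<kappa>(3) by blast
  moreover have "der x b = der u b + a * der d b" "der y a = der v a + b * der d a"
    by (simp_all add: x y der_add_D der_scale_D)
  ultimately show ?thesis
    unfolding u_def[symmetric] v_def[symmetric] unfolding a_def[symmetric] b_def[symmetric]
    by (simp add: algebra_simps)
qed

text \<open>The \<open>D\<close>-module \<open>D'/D\<close> has rank one, so it is trivial: it is spanned by some \<open>d\<close> with
  \<open>[D, d] \<subseteq> D\<close>. For such a \<open>d\<close> the form \<open>\<kappa>\<close> with kernel \<open>D\<close> and \<open>\<kappa> d = 1\<close> is closed.\<close>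

lemma closed_codim_one_form:
  assumes D: "lie_subspace dscale bracket D" "lie_subspace dscale bracket D'" "D \<subseteq> D'"
    and dim: "D.dim D' = D.dim D + 1" and closed: "linearly_closed dscale bracket der D"
  obtains d \<kappa> where "d \<in> D'" "\<kappa> d = 1" "\<And>x. x \<in> D \<Longrightarrow> \<kappa> x = 0"
    and "\<And>x. x \<in> D' \<Longrightarrow> x - dscale (\<kappa> x) d \<in> D"
    and "\<And>x y. x \<in> D' \<Longrightarrow> y \<in> D' \<Longrightarrow> \<kappa> (x + y) = \<kappa> x + \<kappa> y"
    and "\<And>c x. x \<in> D' \<Longrightarrow> \<kappa> (dscale c x) = c * \<kappa> x"
    and "\<And>x y. x \<in> D' \<Longrightarrow> y \<in> D' \<Longrightarrow> \<kappa> (bracket x y) = der x (\<kappa> y) - der y (\<kappa> x)"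
proof -
  have sub: "D.subspace D" "D.subspace D'"
    and br: "\<And>x y. x \<in> D \<Longrightarrow> y \<in> D \<Longrightarrow> bracket x y \<in> D"
    and br': "\<And>x y. x \<in> D' \<Longrightarrow> y \<in> D' \<Longrightarrow> bracket x y \<in> D'"
    using D by (auto simp: lie_subspace_def)
  note D'_closed = D.subspace_add[OF sub(2)] D.subspace_scale[OF sub(2)] D.subspace_diff[OF sub(2)] br'
  obtain e where e: "e \<in> D'" "e \<notin> D" "\<And>x. x \<in> D' \<Longrightarrow> \<exists>c. x - dscale c e \<in> D"
    using codim_one_complement[OF sub D(3) dim] by blast
  obtain \<mu> where l: "\<And>x. x \<in> D' \<Longrightarrow> x - dscale (\<mu> x) e \<in> D"
    "\<mu> e = 1" "\<And>x. x \<in> D \<Longrightarrow> \<mu> x = 0"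
    "\<And>x y. x \<in> D' \<Longrightarrow> y \<in> D' \<Longrightarrow> \<mu> (x + y) = \<mu> x + \<mu> y"
    "\<And>c x. x \<in> D' \<Longrightarrow> \<mu> (dscale c x) = c * \<mu> x"
    using codim_one_form[OF sub D(3) e] by blast
  \<comment> \<open>\<open>\<alpha>\<close> is the connection form of the rank one
    \<open>D\<close>-module \<open>D'/D\<close> in the generator \<open>e\<close>.\<close>
  define \<alpha> where "\<alpha> x = \<mu> (bracket x e)" for x
  have l_minus: "\<mu> (- x) = - \<mu> x" if "x \<in> D'" for x
    using l(5)[OF that, of "- 1"] by simp
  have l_bracket: "\<mu> (bracket x y) = der x (\<mu> y) + \<mu> y * \<alpha> x" if "x \<in> D" "y \<in> D'" for x y
    using codim_one_form_bracket[OF D e(1) l, of x y] that D(3) by (auto simp: l(3) \<alpha>_def)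
  \<comment> \<open>The class of \<open>f e\<close> is horizontal when
    \<open>der x f = - \<alpha> x * f\<close>. This is a system of size one with \<open>N\<close>
    the identity matrix, whose derivatives vanish, whence \<open>N' = 0\<close>.\<close>
  obtain g h where gh: "inverse_mats 1 g h"
    and g: "\<And>x i j. x \<in> D \<Longrightarrow> der x (g i j) = - \<alpha> x * mmult 1 (mone 1) g i j"
  proof (rule linearly_closed_solve[OF closed D(1), where \<kappa> = "\<lambda>x. - \<alpha> x" and N = "mone 1" and n = 1 and N' = 0])
    fix x y assume xy: "x \<in> D" "y \<in> D"
    then have xy': "x \<in> D'" "y \<in> D'" "bracket x e \<in> D'" "bracket y e \<in> D'"
      using D(3) e(1) br' by auto
    show "- \<alpha> (x + y) = - \<alpha> x + - \<alpha> y"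
      using xy' by (simp add: \<alpha>_def bracket_add_left l(4))
    \<comment> \<open>The Jacobi identity expresses \<open>\<alpha> (bracket x y)\<close> through
      iterated brackets with \<open>e\<close>. By \<open>l_bracket\<close> the products of
      \<open>\<alpha> x\<close> and \<open>\<alpha> y\<close> cancel, which leaves the flatness of
      \<open>- \<alpha>\<close>.\<close>
    have "\<alpha> (bracket x y) = \<mu> (bracket x (bracket y e)) - \<mu> (bracket y (bracket x e))"
      using xy' l(4)[of "bracket x (bracket y e)" "- bracket y (bracket x e)"] br' D.subspace_neg[OF sub(2)]
      by (simp add: \<alpha>_def bracket_bracket l_minus)
    then show "- \<alpha> (bracket x y) = der x (- \<alpha> y) - der y (- \<alpha> x)"
      using xy xy' by (simp add: l_bracket \<alpha>_def[symmetric] der_minus)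
  next
    fix c x assume x: "x \<in> D"
    then have x': "x \<in> D'" "bracket x e \<in> D'"
      using D(3) e(1) br' by auto
    have "\<mu> (dscale c (bracket x e) + dscale (- der e c) x) = c * \<alpha> x"
      by (simp only: l(3)[OF x] l(4,5) \<alpha>_def x' D'_closed mult_zero_right add_0_right)
    then show "- \<alpha> (dscale c x) = c * - \<alpha> x"
      by (simp add: \<alpha>_def bracket_scale_left)
  qed (auto simp: mone_def)
  define f where "f = g 0 0"
  have "g 0 0 * h 0 0 = 1"
    using gh by (simp add: inverse_mats_def mmult_def mone_def fun_eq_iff)
  then have f: "f \<noteq> 0"
    by (auto simp: f_def)
  have der_f: "der x f = - \<alpha> x * f" if "x \<in> D" for x
    using g[OF that, of 0 0] by (simp add: f_def mmult_def mone_def)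
  let ?d = "dscale f e" and ?\<kappa> = "\<lambda>x. \<mu> x / f"
  have d: "?d \<in> D'"
    using D'_closed e(1) by blast
  have \<kappa>: "\<And>x. x \<in> D' \<Longrightarrow> x - dscale (?\<kappa> x) ?d \<in> D" "?\<kappa> ?d = 1" "\<And>x. x \<in> D \<Longrightarrow> ?\<kappa> x = 0"
    "\<And>x y. x \<in> D' \<Longrightarrow> y \<in> D' \<Longrightarrow> ?\<kappa> (x + y) = ?\<kappa> x + ?\<kappa> y"
    "\<And>c x. x \<in> D' \<Longrightarrow> ?\<kappa> (dscale c x) = c * ?\<kappa> x"
    using f l e(1) by (simp_all add: add_divide_distrib)
  \<comment> \<open>This is \<open>[D, f e] \<subseteq> D\<close>. It removes both correction terms
    in \<open>codim_one_form_bracket\<close>.\<close>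
  have 0: "?\<kappa> (bracket x ?d) = 0" if "x \<in> D" for x
    using that d f by (simp add: l_bracket l(2,5) e(1) der_f)
  have "?\<kappa> (bracket x y) = der x (?\<kappa> y) - der y (?\<kappa> x)" if "x \<in> D'" "y \<in> D'" for x y
    using codim_one_form_bracket[OF D d \<kappa> that]
    unfolding 0[OF \<kappa>(1)[OF that(1)]] 0[OF \<kappa>(1)[OF that(2)]] by simp
  then show ?thesis
    using that[OF d \<kappa>(2,3,1,4,5)] by blast
qed

end

section \<open>Matrices with entries in a differential algebra\<close>

context D_algebra
begin

lemma act_zero [simp]: "act x 0 = 0"
  using act_add[of x 0 0] by simp

lemma act_diff: "act x (a - b) = act x a - act x b"
  using act_add[of x "a - b" b] by simp

lemma act_sum: "act x (\<Sum>i\<in>I. f i) = (\<Sum>i\<in>I. act x (f i))"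
  by (induction I rule: infinite_finite_induct) (simp_all add: act_add)

lemma act_one [simp]: "act x 1 = 0"
  using act_mult[of x 1 1] by simp

definition emb :: "(nat \<Rightarrow> nat \<Rightarrow> 'k) \<Rightarrow> nat \<Rightarrow> nat \<Rightarrow> 'a" where
  "emb A i j = ascale (A i j) 1"

definition mact :: "'d \<Rightarrow> (nat \<Rightarrow> nat \<Rightarrow> 'a) \<Rightarrow> nat \<Rightarrow> nat \<Rightarrow> 'a" where
  "mact x A i j = act x (A i j)"

definition mder :: "'d \<Rightarrow> (nat \<Rightarrow> nat \<Rightarrow> 'k) \<Rightarrow> nat \<Rightarrow> nat \<Rightarrow> 'k" where
  "mder x A i j = der x (A i j)"

lemma ascale_one_mult: "ascale c 1 * a = ascale c a"
  using scale_mult[of c 1 a] by simp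

lemma emb_sq_mats [simp]: "A \<in> sq_mats n \<Longrightarrow> emb A \<in> sq_mats n"
  by (auto simp: sq_mats_def emb_def)

lemma mact_sq_mats [simp]: "A \<in> sq_mats n \<Longrightarrow> mact x A \<in> sq_mats n"
  by (auto simp: sq_mats_def mact_def)

lemma mder_sq_mats [simp]: "A \<in> sq_mats n \<Longrightarrow> mder x A \<in> sq_mats n"
  by (auto simp: sq_mats_def mder_def)

lemma emb_mmult: "emb (mmult n A B) = mmult n (emb A) (emb B)"
  by (simp add: fun_eq_iff emb_def mmult_def M.scale_sum_left ascale_one_mult)

lemma emb_add: "emb (A + B) = emb A + emb B"
  and emb_diff: "emb (A - B) = emb A - emb B"
  by (simp_all add: fun_eq_iff emb_def M.scale_left_distrib M.scale_left_diff_distrib)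

lemma emb_mone: "emb (mone n) = mone n"
  by (auto simp: fun_eq_iff emb_def mone_def)

lemma emb_inverse_mats: "inverse_mats n g h \<Longrightarrow> inverse_mats n (emb g) (emb h)"
  by (auto simp: inverse_mats_def simp flip: emb_mmult emb_mone)

lemma mact_emb: "mact x (emb A) = emb (mder x A)"
  using act_scale[of x 1] by (simp add: fun_eq_iff mact_def emb_def mder_def)

lemma mact_mmult: "mact x (mmult n A B) = mmult n (mact x A) B + mmult n A (mact x B)"
  by (simp add: fun_eq_iff mact_def mmult_def act_sum act_mult sum.distrib)

lemma mact_zero [simp]: "mact x 0 = 0"
  by (simp add: fun_eq_iff mact_def)

lemma mact_mone [simp]: "mact x (mone n) = 0"
  by (simp add: fun_eq_iff mact_def mone_def)

lemma mact_diff: "mact x (A - B) = mact x A - mact x B"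
  by (simp add: fun_eq_iff mact_def act_diff)

section \<open>Commutators and conjugation by matrices over the base field\<close>

definition comm :: "nat \<Rightarrow> (nat \<Rightarrow> nat \<Rightarrow> 'k) \<Rightarrow> (nat \<Rightarrow> nat \<Rightarrow> 'a) \<Rightarrow> nat \<Rightarrow> nat \<Rightarrow> 'a" where
  "comm n A Q = mmult n (emb A) Q - mmult n Q (emb A)"

lemma comm_add: "comm n (A + B) Q = comm n A Q + comm n B Q"
  and comm_diff: "comm n (A - B) Q = comm n A Q - comm n B Q"
  by (simp_all add: comm_def emb_add emb_diff mmult_add_left mmult_add_right mmult_diff_left mmult_diff_right)

lemma comm_zero [simp]: "comm n 0 Q = 0"
  using comm_diff[of n 0 0 Q] by simp

lemma comm_scale: "comm n (\<lambda>i j. c * A i j) Q = (\<lambda>i j. ascale c (comm n A Q i j))"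
  by (simp add: fun_eq_iff comm_def emb_def mmult_def M.scale_sum_right M.scale_right_diff_distrib
      ascale_one_mult mult.commute[of "Q _ _"])

lemma mact_comm: "mact x Q = 0 \<Longrightarrow> mact x (comm n A Q) = comm n (mder x A) Q"
  by (simp add: comm_def mact_diff mact_mmult mact_emb)

text \<open>For \<open>h\<close> inverse to \<open>g\<close>, this is the coefficient matrix after a
  change of basis, the columns of \<open>g\<close> being the new basis vectors in the old
  coordinates.\<close>

definition conj :: "nat \<Rightarrow> (nat \<Rightarrow> nat \<Rightarrow> 'k) \<Rightarrow> (nat \<Rightarrow> nat \<Rightarrow> 'k) \<Rightarrow> (nat \<Rightarrow> nat \<Rightarrow> 'a) \<Rightarrow> nat \<Rightarrow> nat \<Rightarrow> 'a" where
  "conj n g h Q = mmult n (emb h) (mmult n Q (emb g))"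

lemma conj_sq_mats: "inverse_mats n g h \<Longrightarrow> Q \<in> sq_mats n \<Longrightarrow> conj n g h Q \<in> sq_mats n"
  by (simp add: conj_def inverse_mats_def)

lemma conj_conj: "conj n g' h' (conj n g h Q) = conj n (mmult n g g') (mmult n h' h) Q"
  by (simp add: conj_def emb_mmult mmult_assoc)

lemma conj_inverse:
  assumes "inverse_mats n g h" "Q \<in> sq_mats n"
  shows "conj n h g (conj n g h Q) = Q"
  using assms unfolding conj_conj by (simp add: conj_def inverse_mats_def emb_mone)

text \<open>\<open>N\<close> transforms like a connection matrix under a change of gauge.
  Differentiating \<open>h g = 1\<close> gives the derivative of \<open>h\<close> as
  \<open>- h (x g) h\<close>. In particular, a solution of \<open>x g = N g\<close> makes the
  conjugate of \<open>Q\<close> constant along \<open>x\<close>.\<close>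

lemma mact_conj:
  assumes gh: "inverse_mats n g h" and Q: "Q \<in> sq_mats n" and N: "N \<in> sq_mats n" "mact x Q = comm n N Q"
  shows "mact x (conj n g h Q) = comm n (mmult n h (mmult n N g - mder x g)) (conj n g h Q)"
proof -
  define G H G' H' M where "G = emb g" and "H = emb h" and "G' = emb (mder x g)" and "H' = mact x H" and "M = emb N"
  have GH: "inverse_mats n G H"
    using emb_inverse_mats[OF gh] by (simp add: G_def H_def)
  have sq: "G \<in> sq_mats n" "H \<in> sq_mats n" "G' \<in> sq_mats n" "H' \<in> sq_mats n" "M \<in> sq_mats n"
    using gh N GH by (simp_all add: inverse_mats_def G'_def H'_def M_def)
  have G': "mact x G = G'"
    by (simp add: G_def G'_def mact_emb)
  have "mact x (mmult n H G) = 0"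
    using GH by (simp add: inverse_mats_def)
  then have H'G: "mmult n H' G = - mmult n H G'"
    by (simp add: mact_mmult G' H'_def eq_neg_iff_add_eq_0)
  have H': "mmult n H' A = - mmult n H (mmult n G' (mmult n H A))" if "A \<in> sq_mats n" for A
  proof -
    have "mmult n H' A = mmult n (mmult n H' G) (mmult n H A)"
      using inverse_mats_cancel[OF GH that] by (simp add: mmult_assoc)
    then show ?thesis
      by (simp add: H'G mmult_uminus_left mmult_assoc)
  qed
  have "mact x (conj n g h Q) = mmult n H' (mmult n Q G) + mmult n H (mmult n (mmult n M Q - mmult n Q M) G + mmult n Q G')"
    by (simp add: conj_def mact_mmult G' N(2) comm_def flip: G_def H_def H'_def M_def)
  also have "\<dots> = mmult n (mmult n H (mmult n M G - G')) (conj n g h Q) - mmult n (conj n g h Q) (mmult n H (mmult n M G - G'))"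
    unfolding conj_def G_def[symmetric] H_def[symmetric]
    using sq Q GH
    by (simp add: H' mmult_assoc mmult_diff_left mmult_diff_right mmult_add_right inverse_mats_cancel)
  finally show ?thesis
    by (simp add: comm_def emb_mmult emb_diff G_def H_def G'_def M_def)
qed

text \<open>\<open>N\<close> is made constant on \<open>D\<close> by annihilating its pivot coordinates modulo the commutant \<open>H\<close> of \<open>Q\<close>:
  derivatives along \<open>D\<close> then lie in \<open>H\<close> and have no pivot coordinates, hence vanish.\<close>

lemma constant_extension:
  assumes D: "lie_subspace dscale bracket D" "lie_subspace dscale bracket D'" "D \<subseteq> D'"
    and dim: "D.dim D' = D.dim D + 1"
    and closed: "linearly_closed dscale bracket der D" "linearly_closed dscale bracket der D'"
    and Q: "Q \<in> sq_mats n" "\<And>x. x \<in> D \<Longrightarrow> mact x Q = 0"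
    and ex: "\<And>x. x \<in> D' \<Longrightarrow> \<exists>N\<in>sq_mats n. mact x Q = comm n N Q"
  obtains g h where "inverse_mats n g h" "\<And>x. x \<in> D' \<Longrightarrow> mact x (conj n g h Q) = 0"
proof -
  obtain d \<kappa> where d: "d \<in> D'" "\<kappa> d = 1" and \<kappa>0: "\<And>x. x \<in> D \<Longrightarrow> \<kappa> x = 0"
    and \<kappa>: "\<And>x. x \<in> D' \<Longrightarrow> x - dscale (\<kappa> x) d \<in> D"
    and add: "\<And>x y. x \<in> D' \<Longrightarrow> y \<in> D' \<Longrightarrow> \<kappa> (x + y) = \<kappa> x + \<kappa> y"
    and scale: "\<And>c x. x \<in> D' \<Longrightarrow> \<kappa> (dscale c x) = c * \<kappa> x"
    and flat: "\<And>x y. x \<in> D' \<Longrightarrow> y \<in> D' \<Longrightarrow> \<kappa> (bracket x y) = der x (\<kappa> y) - der y (\<kappa> x)"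
    using closed_codim_one_form[OF D dim closed(1)] by blast
  obtain N where N: "N \<in> sq_mats n" "mact d Q = comm n N Q"
    using ex d by blast
  define H where "H = {A \<in> sq_mats n. comm n A Q = 0}"
  \<comment> \<open>Since \<open>[x, d]\<close> lies in \<open>D\<close>, both \<open>[x, d]\<close>
    and \<open>x\<close> kill \<open>Q\<close>, so \<open>x\<close> kills
    \<open>d Q = [N, Q]\<close>. As \<open>Q\<close> is constant along \<open>x\<close>, the result
    is \<open>[x N, Q] = 0\<close>.\<close>
  have N_H: "mder x N \<in> H" if x: "x \<in> D" for x
  proof -
    have "bracket x d \<in> D'"
      using x d D by (auto simp: lie_subspace_def)
    moreover have "\<kappa> (bracket x d) = 0"
      using x d D(3) by (simp add: flat subset_iff \<kappa>0)
    ultimately have "bracket x d \<in> D"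
      using \<kappa>[of "bracket x d"] by simp
    then have "mact (bracket x d) Q = 0"
      by (rule Q)
    moreover have "mact (bracket x d) Q = mact x (mact d Q) - mact d (mact x Q)"
      by (simp add: fun_eq_iff mact_def act_bracket)
    ultimately have "mact x (comm n N Q) = 0"
      using Q(2)[OF x] N by simp
    then show ?thesis
      using N by (simp add: H_def mact_comm[OF Q(2)[OF x]])
  qed
  have H_der: "mder x A \<in> H" if "x \<in> D" "A \<in> H" for x A
    using that mact_comm[OF Q(2)[OF that(1)], of n A] by (simp add: H_def)
  have H_scale: "(\<lambda>i j. c * A i j) \<in> H" if "A \<in> H" for c A
    using that by (simp add: H_def sq_mats_scale comm_scale) (simp add: fun_eq_iff)
  have H_add: "A + B \<in> H" if "A \<in> H" "B \<in> H" for A B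
    using that by (simp add: H_def comm_add sq_mats_add)
  have H_diff: "A - B \<in> H" if "A \<in> H" "B \<in> H" for A B
    using that by (simp add: H_def comm_diff sq_mats_diff)
  obtain S where S: "\<And>A. A \<in> H \<Longrightarrow> (\<And>i j. (i, j) \<in> S \<Longrightarrow> A i j = 0) \<Longrightarrow> A = 0"
    and S_ex: "\<And>v. \<exists>A\<in>H. \<forall>(i, j)\<in>S. A i j = v i j"
  proof (rule pivot_coordinates[of H n])
    show "H \<subseteq> sq_mats n" "0 \<in> H"
      by (auto simp: H_def)
  qed (use H_add H_scale in auto)
  obtain A where A: "A \<in> H" "\<And>i j. (i, j) \<in> S \<Longrightarrow> A i j = N i j"
    using S_ex[of N] by auto
  define N' where "N' = N - A"
  have N': "N' \<in> sq_mats n" "mact d Q = comm n N' Q"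
    using N A by (simp_all add: N'_def H_def comm_diff sq_mats_diff)
  have der_N': "der x (N' i j) = 0" if x: "x \<in> D" for x i j
  proof -
    have "mder x N' = mder x N - mder x A"
      by (simp add: fun_eq_iff mder_def N'_def der_diff)
    then have "mder x N' \<in> H"
      using H_diff[OF N_H[OF x] H_der[OF x A(1)]] by simp
    moreover have "mder x N' i j = 0" if "(i, j) \<in> S" for i j
      using A(2)[OF that] by (simp add: mder_def N'_def)
    ultimately have "mder x N' = 0"
      using S by blast
    then show ?thesis
      by (simp add: mder_def fun_eq_iff)
  qed
  have split: "f x = f (x - dscale (\<kappa> x) d) + f (dscale (\<kappa> x) d)"
    if "\<And>x y. f (x + y) = f x + f y" for f :: "'d \<Rightarrow> 'x::ab_group_add" and x
    using that[of "x - dscale (\<kappa> x) d" "dscale (\<kappa> x) d"] by simp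
  \<comment> \<open>\<open>x - \<kappa>(x) d\<close> lies in \<open>D\<close> and kills
    \<open>N'\<close>, so only the component along \<open>d\<close> contributes. This is the form of
    derivative that \<open>linearly_closed_solve\<close> requires.\<close>
  have der_N'_D': "der x (N' i j) = \<kappa> x * der d (N' i j)" if "x \<in> D'" for x i j
    using split[of "\<lambda>x. der x (N' i j)" x] der_N'[OF \<kappa>[OF that]] by (simp add: der_add_D der_scale_D)
  obtain g h where gh: "inverse_mats n g h"
    and g: "\<And>x i j. x \<in> D' \<Longrightarrow> der x (g i j) = \<kappa> x * mmult n N' g i j"
    by (rule linearly_closed_solve[OF closed(2) D(2) add scale flat N'(1) der_N'_D']) blast+
  \<comment> \<open>Along \<open>x\<close> the connection matrix of \<open>Q\<close> is
    \<open>\<kappa>(x) N'\<close>, again because \<open>x - \<kappa>(x) d\<close> kills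
    \<open>Q\<close>. The equation for \<open>g\<close> says that the gauge change by
    \<open>g\<close> turns it into zero.\<close>
  have "mact x (conj n g h Q) = 0" if x: "x \<in> D'" for x
  proof -
    let ?N = "\<lambda>i j. \<kappa> x * N' i j"
    have "mact x Q i j = \<kappa>_part" if "\<kappa>_part = comm n ?N Q i j" for i j \<kappa>_part
      using split[of "\<lambda>x. act x (Q i j)" x] fun_cong[OF fun_cong[OF Q(2)[OF \<kappa>[OF x]], of i], of j]
        fun_cong[OF fun_cong[OF N'(2), of i], of j] that
      by (simp add: mact_def act_add_D act_scale_D comm_scale)
    then have "mact x Q = comm n ?N Q"
      by (simp add: fun_eq_iff)
    moreover have "?N \<in> sq_mats n"
      using N' by (auto simp: sq_mats_def)
    moreover have "mmult n ?N g = mder x g"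
      using g[OF x] by (simp add: fun_eq_iff mder_def mmult_def sum_distrib_left mult.assoc)
    ultimately show ?thesis
      using mact_conj[OF gh Q(1), of ?N x] by simp
  qed
  then show ?thesis
    using that gh by blast
qed

text \<open>Constancy in different bases of \<open>V\<close> for different \<open>x\<close> cannot
  be combined directly. The weaker condition that \<open>x Q\<close> is a commutator can, because
  \<open>comm\<close> is linear in \<open>N\<close>.\<close>

lemma comm_everywhere:
  assumes ds: "basis_of dscale ds"
    and conj: "\<And>x. x \<in> set ds \<Longrightarrow> \<exists>g h. inverse_mats n g h \<and> mact x (conj n g h Q) = 0"
    and Q: "Q \<in> sq_mats n"
  shows "\<exists>N\<in>sq_mats n. mact x Q = comm n N Q"
proof -
  let ?T = "{x. \<exists>N\<in>sq_mats n. mact x Q = comm n N Q}"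
  have "D.subspace ?T"
    unfolding D.subspace_def
  proof (intro conjI allI ballI)
    have "mact 0 Q = 0"
      using act_add_D[of 0 0] by (simp add: fun_eq_iff mact_def)
    then show "0 \<in> ?T"
      by (auto intro!: bexI[of _ 0])
  next
    fix x y assume "x \<in> ?T" "y \<in> ?T"
    then obtain N N' where "N \<in> sq_mats n" "mact x Q = comm n N Q" "N' \<in> sq_mats n" "mact y Q = comm n N' Q"
      by blast
    moreover have "mact (x + y) Q = mact x Q + mact y Q"
      by (simp add: fun_eq_iff mact_def act_add_D)
    ultimately show "x + y \<in> ?T"
      by (auto intro!: bexI[of _ "N + N'"] simp: sq_mats_add comm_add)
  next
    fix c x assume "x \<in> ?T"
    then obtain N where "N \<in> sq_mats n" "mact x Q = comm n N Q"
      by blast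
    moreover have "mact (dscale c x) Q = (\<lambda>i j. ascale c (mact x Q i j))"
      by (simp add: fun_eq_iff mact_def act_scale_D)
    ultimately show "dscale c x \<in> ?T"
      by (auto intro!: bexI[of _ "\<lambda>i j. c * N i j"] simp: sq_mats_scale comm_scale)
  qed
  moreover have "set ds \<subseteq> ?T"
  proof
    fix x assume "x \<in> set ds"
    then obtain g h where gh: "inverse_mats n g h" and 0: "mact x (conj n g h Q) = 0"
      using conj by blast
    have hg: "inverse_mats n h g"
      using gh by (simp add: inverse_mats_def)
    \<comment> \<open>The constant conjugate has connection matrix 0; conjugating back to
      \<open>Q\<close> turns it into \<open>- g (x h)\<close>.\<close>
    have "mact x (conj n h g (conj n g h Q)) = comm n (mmult n g (mmult n 0 h - mder x h)) (conj n h g (conj n g h Q))"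
      by (rule mact_conj[OF hg conj_sq_mats[OF gh Q]]) (use 0 in auto)
    moreover have "mmult n g (mmult n 0 h - mder x h) \<in> sq_mats n"
      using gh by (intro sq_mats_mmult sq_mats_diff) (simp_all add: inverse_mats_def)
    ultimately show "x \<in> ?T"
      using conj_inverse[OF gh Q] by auto
  qed
  ultimately have "D.span (set ds) \<subseteq> ?T"
    using D.span_minimal by blast
  then show ?thesis
    using ds by (auto simp: basis_of_def)
qed

text \<open>Climb the filtration with \<open>constant_extension\<close>, composing the changes of
  basis along the way.\<close>

lemma filtered_constant:
  assumes filt: "filtered_linearly_closed dscale bracket der" and closed: "linearly_closed dscale bracket der UNIV"
    and Q: "Q \<in> sq_mats n" and ex: "\<And>x. \<exists>N\<in>sq_mats n. mact x Q = comm n N Q"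
  obtains g h where "inverse_mats n g h" "\<And>x. mact x (conj n g h Q) = 0"
proof -
  obtain m F where *: "F (0::nat) = {0} \<and> F m = UNIV \<and> (\<forall>i\<le>m. lie_subspace dscale bracket (F i))
      \<and> (\<forall>i<m. F i \<subseteq> F (Suc i) \<and> D.dim (F (Suc i)) = D.dim (F i) + 1 \<and> linearly_closed dscale bracket der (F i))"
    using filt unfolding filtered_linearly_closed_def by (elim exE)
  then have F: "F 0 = {0}" "F m = UNIV"
    and lie: "\<And>i. i \<le> m \<Longrightarrow> lie_subspace dscale bracket (F i)"
    and step: "\<And>i. i < m \<Longrightarrow> F i \<subseteq> F (Suc i)"
      "\<And>i. i < m \<Longrightarrow> D.dim (F (Suc i)) = D.dim (F i) + 1"
    and cl: "\<And>i. i < m \<Longrightarrow> linearly_closed dscale bracket der (F i)"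
    by simp_all
  \<comment> \<open>Each step needs closedness for both \<open>F i\<close> and
    \<open>F (Suc i)\<close>. The filtration provides it below the top, and \<open>closed\<close>
    provides it for the top.\<close>
  have cl': "linearly_closed dscale bracket der (F i)" if "i \<le> m" for i
    using that cl closed F(2) by (cases "i = m") auto
  have "\<exists>g h. inverse_mats n g h \<and> (\<forall>x\<in>F i. mact x (conj n g h Q) = 0)" if "i \<le> m" for i
    using that
  proof (induction i)
    case 0
    have "mact 0 R = 0" for R
      using act_add_D[of 0 0] by (simp add: fun_eq_iff mact_def)
    then show ?case
      using inverse_mats_mone F(1) by auto
  next
    case (Suc i)
    then obtain g h where gh: "inverse_mats n g h" and 0: "\<And>x. x \<in> F i \<Longrightarrow> mact x (conj n g h Q) = 0"
      by (meson Suc_leD)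
    let ?Q = "conj n g h Q"
    \<comment> \<open>The commutator condition survives the change of basis already made, with
      \<open>N\<close> replaced by its gauge transform.\<close>
    have ex': "\<exists>N\<in>sq_mats n. mact x ?Q = comm n N ?Q" for x
    proof -
      obtain N where N: "N \<in> sq_mats n" "mact x Q = comm n N Q"
        using ex by blast
      have "mmult n N g - mder x g \<in> sq_mats n"
        using gh N by (simp add: inverse_mats_def sq_mats_diff)
      then show ?thesis
        using mact_conj[OF gh Q N] gh by (auto simp: inverse_mats_def intro!: bexI sq_mats_mmult)
    qed
    obtain g' h' where "inverse_mats n g' h'" "\<And>x. x \<in> F (Suc i) \<Longrightarrow> mact x (conj n g' h' ?Q) = 0"
      using constant_extension[OF lie lie step(1) step(2) cl' cl' conj_sq_mats[OF gh Q] 0 ex'] Suc.prems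
      by (metis Suc_le_eq less_imp_le)
    then show ?case
      using inverse_mats_mmult[OF gh] unfolding conj_conj by blast
  qed
  then show ?thesis
    using that F(2) by blast
qed

end

section \<open>Change of basis\<close>

lemma inverse_mats_vec:
  assumes "inverse_mats n g h" "i < n"
  shows "(\<Sum>l<n. g i l * (\<Sum>m<n. h l m * a m)) = a i"
proof -
  have "(\<Sum>l<n. g i l * (\<Sum>m<n. h l m * a m)) = (\<Sum>l<n. \<Sum>m<n. g i l * h l m * a m)"
    by (simp add: sum_distrib_left mult.assoc)
  also have "\<dots> = (\<Sum>m<n. mmult n g h i m * a m)"
    unfolding mmult_def sum_distrib_right by (rule sum.swap)
  also have "\<dots> = (\<Sum>m<n. if i = m then a m else 0)"
    using assms by (intro sum.cong) (auto simp: inverse_mats_def mone_def)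
  finally show ?thesis
    using assms by simp
qed

text \<open>\<open>g h = 1\<close> gives spanning, as \<open>h\<close> converts old coordinates into
  new ones; \<open>h g = 1\<close> gives independence.\<close>

lemma (in based_vector_space) basis_of_transformed:
  assumes gh: "inverse_mats n g h" and n: "n = length es"
  shows "basis_of scale (map (\<lambda>j. \<Sum>i<n. scale (g i j) (es ! i)) [0..<n])" (is "basis_of scale ?es'")
proof (rule basis_ofI)
  have hg: "inverse_mats n h g"
    using gh by (simp add: inverse_mats_def)
  have comb: "(\<Sum>j<length ?es'. scale (a j) (?es' ! j)) = (\<Sum>i<n. scale (\<Sum>j<n. g i j * a j) (es ! i))" for a
  proof -
    have "(\<Sum>j<length ?es'. scale (a j) (?es' ! j)) = (\<Sum>j<n. \<Sum>i<n. scale (g i j * a j) (es ! i))"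
      by (simp add: scale_sum_right mult.commute)
    also have "\<dots> = (\<Sum>i<n. \<Sum>j<n. scale (g i j * a j) (es ! i))"
      by (rule sum.swap)
    finally show ?thesis
      by (simp add: scale_sum_left)
  qed
  show "\<exists>a. v = (\<Sum>j<length ?es'. scale (a j) (?es' ! j))" for v
  proof
    show "v = (\<Sum>j<length ?es'. scale (\<Sum>m<n. h j m * coords v m) (?es' ! j))"
      unfolding comb using sum_coords[of v] inverse_mats_vec[OF gh] n by simp
  qed
  fix a assume "(\<Sum>j<length ?es'. scale (a j) (?es' ! j)) = 0"
  then have 0: "(\<Sum>i<length es. scale (\<Sum>j<n. g i j * a j) (es ! i)) = (\<Sum>i<length es. scale 0 (es ! i))"
    unfolding comb n[symmetric] by simp
  have "(\<Sum>j<n. g i j * a j) = 0" if "i < n" for i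
    using arg_cong[OF 0, of "\<lambda>v. coords v i"] that n by (simp only: coords_lincomb)
  then have "a i = 0" if "i < n" for i
    using inverse_mats_vec[OF hg that, of a] by simp
  then show "\<forall>i<length ?es'. a i = 0"
    by simp
qed

context D_algebra
begin

text \<open>Bases of \<open>V\<close> correspond to invertible matrices over \<open>k\<close>, and
  coefficient matrices to conjugates of \<open>Q\<close>. Conjugacy thereby becomes a statement
  about the single matrix \<open>Q\<close>.\<close>

lemma conjugate_to_constant_iff:
  fixes vscale :: "'k \<Rightarrow> 'v::ab_group_add \<Rightarrow> 'v"
  assumes rep: "fin_dim_representation ascale comult counit vscale coact"
    and P: "coefficient_matrix ascale vscale coact es P"
  defines "n \<equiv> length es"
  defines "Q \<equiv> \<lambda>i j. if i < n \<and> j < n then P $$ (i, j) else 0"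
  shows "conjugate_to_constant ascale act vscale coact X \<longleftrightarrow>
    (\<exists>g h. inverse_mats n g h \<and> (\<forall>x\<in>X. mact x (conj n g h Q) = 0))"
proof -
  interpret R: fin_dim_representation ascale comult counit vscale coact by fact
  have n: "n = length es"
    by (simp add: n_def)
  have tensor: "based_tensor vscale es' ascale" if "basis_of vscale es'" for es'
    using that by unfold_locales
  have es: "basis_of vscale es"
    using P by (simp add: coefficient_matrix_def)
  interpret e: based_tensor vscale es ascale
    by (rule tensor[OF es])
  have Q: "Q i j = e.tcoef i (coact (es ! j))" if "i < n" "j < n" for i j
    using P that e.coefficient_matrix_iff[of coact P] by (simp add: Q_def n_def)
  define tr where "tr es' = (\<lambda>i j. if i < n \<and> j < n then e.coords (es' ! j) i else 0)" for es'
  define tr' where "tr' es' = (\<lambda>i j. if i < n \<and> j < n then based_vector_space.coords vscale es' (es ! j) i else 0)" for es'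
  have tr: "inverse_mats n (tr es') (tr' es')" and len: "length es' = n"
    and change: "\<And>i j. i < n \<Longrightarrow> j < n \<Longrightarrow>
      based_tensor.tcoef vscale es' ascale i (coact (es' ! j)) = conj n (tr es') (tr' es') Q i j"
    if es': "basis_of vscale es'" for es'
  proof -
    interpret e': based_tensor vscale es' ascale
      by (rule tensor[OF es'])
    show len: "length es' = n"
      using R.V.basis_of_same_length[OF es es'] n_def by simp
    have "mmult n (tr es') (tr' es') = mone n" "mmult n (tr' es') (tr es') = mone n"
      using basis_change_inverse[OF e.based_vector_space_axioms e'.based_vector_space_axioms n]
        basis_change_inverse[OF e'.based_vector_space_axioms e.based_vector_space_axioms len[symmetric]]
      by (simp_all add: tr_def tr'_def)
    then show "inverse_mats n (tr es') (tr' es')"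
      by (auto simp: inverse_mats_def tr_def tr'_def sq_mats_def)
    fix i j assume ij: "i < n" "j < n"
    \<comment> \<open>Expressing the new vectors in the old basis multiplies \<open>Q\<close> by the
      transition matrix on the right. Passing to new coordinates in \<open>V\<close> will then
      multiply by its inverse on the left.\<close>
    have "e.tcoef m (coact (es' ! j)) = mmult n Q (emb (tr es')) m j" if "m < n" for m
    proof -
      have "e.tcoef m (coact (es' ! j)) = e.tcoef m (coact (\<Sum>l<n. vscale (e.coords (es' ! j) l) (es ! l)))"
        using e.sum_coords by (simp add: n_def)
      also have "\<dots> = (\<Sum>l<n. ascale (e.coords (es' ! j) l) (e.tcoef m (coact (es ! l))))"
        by (rule e.tcoef_linear[OF R.coact_add R.coact_scale])
      also have "\<dots> = mmult n Q (emb (tr es')) m j"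
        unfolding mmult_def using ij that
        by (intro sum.cong) (auto simp: Q tr_def emb_def ascale_one_mult mult.commute[of _ "ascale _ 1"])
      finally show ?thesis .
    qed
    then show "e'.tcoef i (coact (es' ! j)) = conj n (tr es') (tr' es') Q i j"
      unfolding tcoef_change[OF e.based_tensor_axioms e'.based_tensor_axioms] conj_def
        mmult_def[of n "emb (tr' es')"]
      using ij by (intro sum.cong) (auto simp: tr'_def emb_def ascale_one_mult n_def)
  qed
  show ?thesis
  proof
    assume "conjugate_to_constant ascale act vscale coact X"
    then obtain es' P' where P': "coefficient_matrix ascale vscale coact es' P'"
      and const: "elements_mat P' \<subseteq> D_constants act X UNIV"
      unfolding conjugate_to_constant_def by blast
    then have es': "basis_of vscale es'"
      by (simp add: coefficient_matrix_def)
    interpret e': based_tensor vscale es' ascale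
      by (rule tensor[OF es'])
    have sq: "conj n (tr es') (tr' es') Q \<in> sq_mats n"
      by (rule conj_sq_mats[OF tr[OF es']]) (auto simp: Q_def sq_mats_def)
    have "mact x (conj n (tr es') (tr' es') Q) = 0" if x: "x \<in> X" for x
    proof (rule sq_mats_eqI[of _ n])
      fix i j assume ij: "i < n" "j < n"
      have P'_dim: "P' \<in> carrier_mat n n" and P'_eq: "P' $$ (i, j) = e'.tcoef i (coact (es' ! j))"
        using P' ij len[OF es'] e'.coefficient_matrix_iff[of coact P'] by auto
      have "P' $$ (i, j) \<in> elements_mat P'"
        by (rule elements_matI[OF P'_dim ij refl])
      then have "act x (P' $$ (i, j)) = 0"
        using const x by (auto simp: D_constants_def)
      then show "mact x (conj n (tr es') (tr' es') Q) i j = 0 i j"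
        using change[OF es' ij] by (simp add: mact_def P'_eq)
    qed (use sq in auto)
    then show "\<exists>g h. inverse_mats n g h \<and> (\<forall>x\<in>X. mact x (conj n g h Q) = 0)"
      using tr[OF es'] by blast
  next
    assume "\<exists>g h. inverse_mats n g h \<and> (\<forall>x\<in>X. mact x (conj n g h Q) = 0)"
    then obtain g h where gh: "inverse_mats n g h" and const: "\<And>x. x \<in> X \<Longrightarrow> mact x (conj n g h Q) = 0"
      by blast
    define es' where "es' = map (\<lambda>j. \<Sum>i<n. vscale (g i j) (es ! i)) [0..<n]"
    have es': "basis_of vscale es'"
      unfolding es'_def by (rule e.basis_of_transformed[OF gh n])
    interpret e': based_tensor vscale es' ascale
      by (rule tensor[OF es'])
    \<comment> \<open>The new basis was built from the columns of \<open>g\<close>, so its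
      transition matrix is \<open>g\<close>; then \<open>tr' es' = h\<close> by uniqueness of
      inverses.\<close>
    have "tr es' = g"
      using tr[OF es'] gh e.coords_lincomb
      by (intro sq_mats_eqI[of _ n]) (auto simp: inverse_mats_def tr_def es'_def n_def)
    moreover have "tr' es' = h"
    proof -
      have "tr' es' = mmult n (tr' es') (mmult n (tr es') h)"
        using tr[OF es'] gh by (simp add: \<open>tr es' = g\<close> inverse_mats_def)
      also have "\<dots> = h"
        using inverse_mats_cancel(2)[OF tr[OF es']] gh by (simp add: inverse_mats_def)
      finally show ?thesis .
    qed
    ultimately have tcoef: "e'.tcoef i (coact (es' ! j)) = conj n g h Q i j" if "i < n" "j < n" for i j
      using change[OF es' that] by simp
    define P' where "P' = mat n n (\<lambda>(i, j). conj n g h Q i j)"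
    have "coefficient_matrix ascale vscale coact es' P'"
      using e'.coefficient_matrix_iff[of coact P'] len[OF es'] tcoef by (simp add: P'_def)
    moreover have "elements_mat P' \<subseteq> D_constants act X UNIV"
      using const by (auto simp: elements_mat_def D_constants_def P'_def mact_def fun_eq_iff)
    ultimately show "conjugate_to_constant ascale act vscale coact X"
      unfolding conjugate_to_constant_def by blast
  qed
qed

end

theorem theorem4p4:
  fixes dscale :: "'k::field_char_0 \<Rightarrow> 'd::ab_group_add \<Rightarrow> 'd"
    and bracket :: "'d \<Rightarrow> 'd \<Rightarrow> 'd"
    and der :: "'d \<Rightarrow> 'k \<Rightarrow> 'k"
    and ascale :: "'k \<Rightarrow> 'a::comm_ring_1 \<Rightarrow> 'a"
    and act :: "'d \<Rightarrow> 'a \<Rightarrow> 'a"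
    and comult :: "'a \<Rightarrow> ('a \<times> 'a \<Rightarrow>\<^sub>0 int)"
    and counit :: "'a \<Rightarrow> 'k"
    and antipode :: "'a \<Rightarrow> 'a"
    and vscale :: "'k \<Rightarrow> 'v::ab_group_add \<Rightarrow> 'v"
    and coact :: "'v \<Rightarrow> ('v \<times> 'a \<Rightarrow>\<^sub>0 int)"
  assumes "differential_field dscale bracket der"
    and "linear_D_group dscale bracket der ascale act comult counit antipode"
    and "fin_dim_representation ascale comult counit vscale coact"
    and "faithful_representation ascale act vscale coact"
    and "filtered_linearly_closed dscale bracket der"
    and "linearly_closed dscale bracket der UNIV"
  shows "conjugate_to_constant ascale act vscale coact UNIV \<longleftrightarrow>
    (\<exists>ds. basis_of dscale ds \<and>
       (\<forall>i<length ds. conjugate_to_constant ascale act vscale coact {ds ! i}))"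
proof -
  interpret G: linear_D_group dscale bracket der ascale act comult counit antipode by fact
  obtain es P where P: "coefficient_matrix ascale vscale coact es P"
    using assms(4) unfolding faithful_representation_def by blast
  define n where "n = length es"
  define Q where "Q = (\<lambda>i j. if i < n \<and> j < n then P $$ (i, j) else 0)"
  have Q: "Q \<in> sq_mats n"
    by (auto simp: Q_def sq_mats_def)
  note iff = G.conjugate_to_constant_iff[OF assms(3) P, folded n_def, folded Q_def]
  show ?thesis
  proof
    \<comment> \<open>One basis of \<open>V\<close> serves all derivations at once, so any basis of
      \<open>D_k\<close> will do.\<close>
    assume "conjugate_to_constant ascale act vscale coact UNIV"
    then have "conjugate_to_constant ascale act vscale coact {x}" for x
      unfolding iff by blast
    moreover obtain ds where "basis_of dscale ds"
      using G.D.basis_of_exists[OF G.finite_dim_D] .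
    ultimately show "\<exists>ds. basis_of dscale ds \<and>
       (\<forall>i<length ds. conjugate_to_constant ascale act vscale coact {ds ! i})"
      by blast
  next
    assume "\<exists>ds. basis_of dscale ds \<and>
       (\<forall>i<length ds. conjugate_to_constant ascale act vscale coact {ds ! i})"
    then obtain ds where ds: "basis_of dscale ds"
      and conj: "\<And>x. x \<in> set ds \<Longrightarrow> conjugate_to_constant ascale act vscale coact {x}"
      by (auto simp: in_set_conv_nth)
    \<comment> \<open>The bases of \<open>V\<close> may differ from one \<open>ds ! i\<close> to
      another; the commutator condition on the fixed matrix \<open>Q\<close> is what extends to all
      of \<open>D_k\<close>.\<close>
    have "\<exists>N\<in>sq_mats n. G.mact x Q = G.comm n N Q" for x
      using G.comm_everywhere[OF ds _ Q] conj unfolding iff by simp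
    then show "conjugate_to_constant ascale act vscale coact UNIV"
      using G.filtered_constant[OF assms(5,6) Q] unfolding iff by metis
  qed
qed

end
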